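(* Let $L>0$ and let $H=(H^1,\dots,H^m):\mathbb R^d\to\mathbb R^m$ satisfy $H^i=H_1^i-H_2^i$ with $H_1^i,H_2^i:\mathbb R^d\to\mathbb R$ convex and nonnegative, and $\|DH\|_\infty<\infty$. For $h>0$, $0\le s\le t\le T$, $\zeta\in C([0,T];\mathbb R^m)$ let $S_h(t,s;\zeta):(B)UC(\mathbb R^d)\to(B)UC(\mathbb R^d)$ be a scheme operator satisfying, for some $\lambda_0>0$: (1) $S_h(t,s;\zeta)(w+c)=S_h(t,s;\zeta)w+c$ for all $c\in\mathbb R$, and $S_h(t,s;\zeta)$ commutes with the translations $w\mapsto w(\cdot+v)$, $v\in\mathbb R^d$; (2) if $w_1\le w_2$ and $\mathrm{osc}(\zeta,s,t)\le\lambda_0h$, then $S_h(t,s;\zeta)w_1\le S_h(t,s;\zeta)w_2$; (3) there is a constant $C_0=C_0(L)>0$ such that, if $\zeta\in C([0,T];\mathbb R^m)$, $\Phi\in C(I,C^{1,1}(\mathbb R^d))$ is a solution of $d\Phi=\sum_{i=1}^mH^i(D\Phi)\circ d\zeta^i$ in $\mathbb R^d\times I$, $s\le t$ in $I$, and $\mathrm{osc}(\zeta,s,t)\le\lambda_0h$, then $\|S_h(t,s;\zeta)\Phi(\cdot,s)-\Phi(\cdot,t)\|_\infty\le C_0\|D^2\Phi\|_\infty h^2$. Let $u_0:\mathbb R^d\to\mathbb R$ be bounded and Lipschitz with $\|Du_0\|_\infty\le L$, and let $W\in C([0,T];\mathbb R^m)$ have modulus of continuity $\omega:[0,\infty)\to[0,\infty)$.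 Define $\rho_h$ implicitly by $$\lambda:=\frac{(\rho_h)^{1/2}\,\omega\big((\rho_h)^{1/2}\big)}{h}<\lambda_0,$$ where $\lambda$ is a fixed constant, set $\mathcal P_h:=\{n\rho_h\wedge T\}_{n=0}^N$, where $N$ is the smallest integer with $N\rho_h\wedge T=T$, $M_h:=\lfloor(\rho_h)^{-1/2}\rfloor$, and $$W_h(t):=W(kM_h\rho_h)+\frac{W((k+1)M_h\rho_h)-W(kM_h\rho_h)}{M_h\rho_h}(t-kM_h\rho_h)$$ for $k\in\mathbb N_0$, $t\in[kM_h\rho_h,(k+1)M_h\rho_h)$. With $t_n:=n\rho_h\wedge T$, let $u_h(\cdot,0):=u_0$, $u_h(\cdot,t):=S_h(t,t_n;W_h)u_h(\cdot,t_n)$ for $t\in(t_n,t_{n+1}]$, $n=0,\dots,N-1$, and let $u$ be the pathwise viscosity solution of $du=\sum_{i=1}^mH^i(Du)\circ dW^i$ in $\mathbb R^d\times(0,T]$, $u(\cdot,0)=u_0$. Then there exists $C=C_{L,\lambda}>0$ such that $$\sup_{(x,t)\in\mathbb R^d\times[0,T]}|u_h(x,t)-u(x,t)|\le C(1+T)\,\omega\big((\rho_h)^{1/2}\big).$$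
   Context: $\mathrm{osc}(\zeta,s,t):=\max_{r_1,r_2\in[s,t]}|\zeta(r_1)-\zeta(r_2)|$; $a\wedge b=\min(a,b)$; $\mathbb N_0=\{0,1,2,\dots\}$. $(B)UC(\mathbb R^d)$ denotes (bounded) uniformly continuous functions. $C_{L,\lambda}$ denotes a constant depending on $L$ and $\lambda$ (the Hamiltonian $H$ and the scheme being fixed). Where values of $W$ at times after $T$ occur in the definition of $W_h$, $W$ is understood to be extended by $W(t)=W(T)$. For an open interval $I\subset[0,T]$, $C(I,C^{1,1}(\mathbb R^d))$ denotes functions $\Phi$ with $\Phi,D\Phi$ continuous on $\mathbb R^d\times I$ and $D\Phi(\cdot,t)$ Lipschitz, locally uniformly in $t$; $\|D^2\Phi\|_\infty$ is the supremum over $t\in I$ of the Lipschitz constants of $D\Phi(\cdot,t)$. For a continuous path $\zeta$, such $\Phi$ is a solution of $d\Phi=\sum_iH^i(D\Phi)\circ d\zeta^i$ in $\mathbb R^d\times I$ if it is obtained by continuous extension from smooth paths: there are $C^1$ paths $\zeta_n\to\zeta$ uniformly on $I$ and $\Phi_n\in C(I,C^{1,1}(\mathbb R^d))$, with Lipschitz constants of $D\Phi_n(\cdot,t)$ bounded uniformly in $n$ locally uniformly in $t$, satisfying $\partial_t\Phi_n=\sum_iH^i(D\Phi_n)\dot\zeta_n^i$ pointwise, with $\Phi_n\to\Phi$ and $D\Phi_n\to D\Phi$ locally uniformly. Pathwise viscosity solutions. An upper (resp. lower) semicontinuous $u$ on $\mathbb R^d\times[0,T]$ is a sub- (resp. super-)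 solution of $du=\sum_iH^i(Du)\circ dW^i$, $u(\cdot,0)=u_0$, if $u(\cdot,0)\le u_0$ (resp. $\ge$) and, whenever $\psi\in C^1([0,T])$, $\Phi\in C(I,C^{1,1}(\mathbb R^d))$ is a solution of $d\Phi=\sum_iH^i(D\Phi)\circ dW^i$ in $\mathbb R^d\times I$, and $u-\Phi-\psi$ attains a local maximum (resp. minimum) at $(x_0,t_0)\in\mathbb R^d\times I$, then $\psi'(t_0)\le0$ (resp. $\ge0$). A solution is both. There is a unique bounded uniformly continuous solution.
   Formalization: Only h with λ ≤ λ₀·ρ_h^{1/2}·M_h are covered (true for all small h; otherwise rounding in M_h can break osc(W_h) ≤ λ₀h or make W_h undefined), λ > 0 is assumed, and in (3) I is open relative to [0,T], so it may contain 0 or T. *)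

theory Defs
  imports "HOL-Analysis.Analysis"
begin

text \<open>
  Functions on \<open>[0,T]\<close>, on an interval \<open>I\<close> or on \<open>\<real>\<^sup>d \<times> [0,T]\<close> are total functions of which only the
  values on that set matter. Space-time functions take the time argument first, so that
  \<open>\<Phi> t\<close> is \<open>\<Phi>(\<cdot>,t)\<close>.
\<close>

section \<open>Function spaces\<close>

definition UC :: "(real ^ 'd \<Rightarrow> real) set" where
  "UC = {w. uniformly_continuous_on UNIV w}"

definition BUC :: "(real ^ 'd \<Rightarrow> real) set" where
  "BUC = {w. uniformly_continuous_on UNIV w \<and> bounded (range w)}"

definition osc :: "(real \<Rightarrow> real ^ 'm) \<Rightarrow> real \<Rightarrow> real \<Rightarrow> real" where
  "osc \<zeta> s t = (SUP (r1, r2) \<in> {s..t} \<times> {s..t}. norm (\<zeta> r1 - \<zeta> r2))"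

definition grad :: "(real ^ 'd \<Rightarrow> real) \<Rightarrow> real ^ 'd \<Rightarrow> real ^ 'd" where
  "grad f x = (THE D. GDERIV f x :> D)"

definition C_C11 :: "real set \<Rightarrow> (real \<Rightarrow> real ^ 'd \<Rightarrow> real) \<Rightarrow> bool" where
  "C_C11 I \<Phi> \<longleftrightarrow>
     continuous_on (I \<times> UNIV) (\<lambda>(t, x). \<Phi> t x) \<and>
     (\<forall>t\<in>I. \<forall>x. \<Phi> t differentiable (at x)) \<and>
     continuous_on (I \<times> UNIV) (\<lambda>(t, x). grad (\<Phi> t) x) \<and>
     (\<forall>J. compact J \<and> J \<subseteq> I \<longrightarrow> (\<exists>K. \<forall>t\<in>J. K-lipschitz_on UNIV (grad (\<Phi> t))))"

text \<open>The supremum over \<open>t \<in> I\<close> of the best Lipschitz constants of \<open>D\<Phi>(\<cdot>,t)\<close>; it may be infinite.\<close>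

definition D2_norm :: "real set \<Rightarrow> (real \<Rightarrow> real ^ 'd \<Rightarrow> real) \<Rightarrow> ennreal" where
  "D2_norm I \<Phi> = (SUP t\<in>I. INF K\<in>{K. K-lipschitz_on UNIV (grad (\<Phi> t))}. ennreal K)"

section \<open>Solutions driven by a continuous path\<close>

definition smooth_solution ::
    "(real ^ 'd \<Rightarrow> real ^ 'm) \<Rightarrow> real set \<Rightarrow> (real \<Rightarrow> real ^ 'm) \<Rightarrow> (real \<Rightarrow> real ^ 'd \<Rightarrow> real) \<Rightarrow> bool" where
  "smooth_solution H I \<zeta> \<Phi> \<longleftrightarrow>
     C_C11 I \<Phi> \<and>
     (\<exists>\<zeta>n \<Phi>n.
        (\<forall>n. \<zeta>n n C1_differentiable_on I) \<and>
        uniform_limit I \<zeta>n \<zeta> sequentially \<and>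
        (\<forall>n. C_C11 I (\<Phi>n n)) \<and>
        (\<forall>J. compact J \<and> J \<subseteq> I \<longrightarrow>
           (\<exists>K. \<forall>n. \<forall>t\<in>J. K-lipschitz_on UNIV (grad (\<Phi>n n t)))) \<and>
        (\<forall>n. \<forall>t\<in>I. \<forall>x.
           ((\<lambda>r. \<Phi>n n r x) has_real_derivative
              (\<Sum>i\<in>UNIV. H (grad (\<Phi>n n t) x) $ i * vector_derivative (\<zeta>n n) (at t) $ i))
             (at t within I)) \<and>
        (\<forall>Q. compact Q \<and> Q \<subseteq> I \<times> UNIV \<longrightarrow>
           uniform_limit Q (\<lambda>n (t, x). \<Phi>n n t x) (\<lambda>(t, x). \<Phi> t x) sequentially \<and>
           uniform_limit Q (\<lambda>n (t, x). grad (\<Phi>n n t) x) (\<lambda>(t, x). grad (\<Phi> t) x) sequentially))"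

section \<open>Pathwise viscosity solutions\<close>

definition usc_on :: "'a::topological_space set \<Rightarrow> ('a \<Rightarrow> real) \<Rightarrow> bool" where
  "usc_on D f \<longleftrightarrow> (\<forall>z\<in>D. \<forall>c>f z. eventually (\<lambda>y. f y < c) (at z within D))"

definition lsc_on :: "'a::topological_space set \<Rightarrow> ('a \<Rightarrow> real) \<Rightarrow> bool" where
  "lsc_on D f \<longleftrightarrow> (\<forall>z\<in>D. \<forall>c<f z. eventually (\<lambda>y. c < f y) (at z within D))"

definition local_max_at :: "'a::topological_space set \<Rightarrow> ('a \<Rightarrow> real) \<Rightarrow> 'a \<Rightarrow> bool" where
  "local_max_at D f z \<longleftrightarrow> z \<in> D \<and> eventually (\<lambda>y. f y \<le> f z) (at z within D)"

definition local_min_at :: "'a::topological_space set \<Rightarrow> ('a \<Rightarrow> real) \<Rightarrow> 'a \<Rightarrow> bool" where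
  "local_min_at D f z \<longleftrightarrow> z \<in> D \<and> eventually (\<lambda>y. f z \<le> f y) (at z within D)"

text \<open>Here \<open>I\<close> is open in \<open>\<real>\<close>, so that tests take place at times in \<open>(0,T)\<close> only.\<close>

definition pathwise_subsolution ::
    "(real ^ 'd \<Rightarrow> real ^ 'm) \<Rightarrow> real \<Rightarrow> (real \<Rightarrow> real ^ 'm) \<Rightarrow> (real ^ 'd \<Rightarrow> real) \<Rightarrow>
     (real \<Rightarrow> real ^ 'd \<Rightarrow> real) \<Rightarrow> bool" where
  "pathwise_subsolution H T W u0 u \<longleftrightarrow>
     usc_on ({0..T} \<times> UNIV) (\<lambda>(t, x). u t x) \<and>
     (\<forall>x. u 0 x \<le> u0 x) \<and>
     (\<forall>I \<psi> \<Phi> t0 x0.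
        open I \<and> is_interval I \<and> I \<subseteq> {0..T} \<and>
        \<psi> C1_differentiable_on {0..T} \<and> smooth_solution H I W \<Phi> \<and>
        local_max_at (I \<times> UNIV) (\<lambda>(t, x). u t x - \<Phi> t x - \<psi> t) (t0, x0)
        \<longrightarrow> deriv \<psi> t0 \<le> 0)"

definition pathwise_supersolution ::
    "(real ^ 'd \<Rightarrow> real ^ 'm) \<Rightarrow> real \<Rightarrow> (real \<Rightarrow> real ^ 'm) \<Rightarrow> (real ^ 'd \<Rightarrow> real) \<Rightarrow>
     (real \<Rightarrow> real ^ 'd \<Rightarrow> real) \<Rightarrow> bool" where
  "pathwise_supersolution H T W u0 u \<longleftrightarrow>
     lsc_on ({0..T} \<times> UNIV) (\<lambda>(t, x). u t x) \<and>
     (\<forall>x. u 0 x \<ge> u0 x) \<and>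
     (\<forall>I \<psi> \<Phi> t0 x0.
        open I \<and> is_interval I \<and> I \<subseteq> {0..T} \<and>
        \<psi> C1_differentiable_on {0..T} \<and> smooth_solution H I W \<Phi> \<and>
        local_min_at (I \<times> UNIV) (\<lambda>(t, x). u t x - \<Phi> t x - \<psi> t) (t0, x0)
        \<longrightarrow> deriv \<psi> t0 \<ge> 0)"

definition pathwise_BUC_solution ::
    "(real ^ 'd \<Rightarrow> real ^ 'm) \<Rightarrow> real \<Rightarrow> (real \<Rightarrow> real ^ 'm) \<Rightarrow> (real ^ 'd \<Rightarrow> real) \<Rightarrow>
     (real \<Rightarrow> real ^ 'd \<Rightarrow> real) \<Rightarrow> bool" where
  "pathwise_BUC_solution H T W u0 u \<longleftrightarrow>
     bounded ((\<lambda>(t, x). u t x) ` ({0..T} \<times> UNIV)) \<and>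
     uniformly_continuous_on ({0..T} \<times> UNIV) (\<lambda>(t, x). u t x) \<and>
     pathwise_subsolution H T W u0 u \<and> pathwise_supersolution H T W u0 u"

section \<open>Scheme operators\<close>

text \<open>
  \<open>S h t s \<zeta>\<close> is \<open>S\<^sub>h(t,s;\<zeta>)\<close>. In the last clause \<open>I\<close> is an interval that is open relative to \<open>[0,T]\<close>,
  so it may contain \<open>0\<close> or \<open>T\<close>. With intervals open in \<open>\<real>\<close>, consistency would say nothing about
  the steps starting at \<open>0\<close> or ending at \<open>T\<close>. The condition \<open>\<Phi> s \<in> UC\<close> says that
  \<open>\<Phi>(\<cdot>,s)\<close> belongs to the domain of \<open>S\<^sub>h(t,s;\<zeta>)\<close>.
\<close>

definition scheme_operator ::
    "(real ^ 'd \<Rightarrow> real ^ 'm) \<Rightarrow> real \<Rightarrow> real \<Rightarrow> real \<Rightarrow>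
     (real \<Rightarrow> real \<Rightarrow> real \<Rightarrow> (real \<Rightarrow> real ^ 'm) \<Rightarrow> (real ^ 'd \<Rightarrow> real) \<Rightarrow> (real ^ 'd \<Rightarrow> real)) \<Rightarrow> bool"
  where
  "scheme_operator H T lam0 C0 S \<longleftrightarrow>
     (\<forall>h s t \<zeta>. 0 < h \<and> 0 \<le> s \<and> s \<le> t \<and> t \<le> T \<and> continuous_on {0..T} \<zeta> \<longrightarrow>
        S h t s \<zeta> ` UC \<subseteq> UC \<and> S h t s \<zeta> ` BUC \<subseteq> BUC \<and>
        (\<forall>w\<in>UC. \<forall>c. S h t s \<zeta> (\<lambda>x. w x + c) = (\<lambda>x. S h t s \<zeta> w x + c)) \<and>
        (\<forall>w\<in>UC. \<forall>v. S h t s \<zeta> (\<lambda>x. w (x + v)) = (\<lambda>x. S h t s \<zeta> w (x + v))) \<and>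
        (osc \<zeta> s t \<le> lam0 * h \<longrightarrow>
           (\<forall>w1\<in>UC. \<forall>w2\<in>UC. (\<forall>x. w1 x \<le> w2 x) \<longrightarrow>
              (\<forall>x. S h t s \<zeta> w1 x \<le> S h t s \<zeta> w2 x))) \<and>
        (\<forall>I \<Phi>.
           is_interval I \<and> openin (top_of_set {0..T}) I \<and> s \<in> I \<and> t \<in> I \<and>
           smooth_solution H I \<zeta> \<Phi> \<and> \<Phi> s \<in> UC \<and> osc \<zeta> s t \<le> lam0 * h \<longrightarrow>
              (\<forall>x. ennreal \<bar>S h t s \<zeta> (\<Phi> s) x - \<Phi> t x\<bar>
                     \<le> ennreal C0 * D2_norm I \<Phi> * ennreal (h\<^sup>2))))"

section \<open>The approximate solution\<close>

definition modulus_of_continuity ::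
    "real \<Rightarrow> (real \<Rightarrow> real) \<Rightarrow> (real \<Rightarrow> real ^ 'm) \<Rightarrow> bool" where
  "modulus_of_continuity T \<omega> W \<longleftrightarrow>
     \<omega> 0 = 0 \<and> mono_on {0..} \<omega> \<and> (\<omega> \<longlongrightarrow> 0) (at_right 0) \<and>
     (\<forall>s\<in>{0..T}. \<forall>t\<in>{0..T}. norm (W s - W t) \<le> \<omega> \<bar>s - t\<bar>)"

text \<open>
  \<open>coarse_steps \<rho>\<close> is \<open>M\<^sub>h\<close>. Without rounding, \<open>sqrt \<rho> * coarse_steps \<rho>\<close> would be \<open>1\<close>. The oscillation of
  the interpolated path over one time step is at most \<open>\<omega> (sqrt \<rho>) / coarse_steps \<rho>\<close>, which is
  \<open>lam * h / (sqrt \<rho> * coarse_steps \<rho>)\<close> when \<open>sqrt \<rho> * \<omega> (sqrt \<rho>) / h = lam\<close>. Because of the rounding,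
  \<open>lam < lam0\<close> alone bounds this by \<open>lam0 * h\<close> only for small \<open>h\<close>.
\<close>

definition coarse_steps :: "real \<Rightarrow> nat" where
  "coarse_steps \<rho> = nat \<lfloor>\<rho> powr (-1/2)\<rfloor>"

definition interpolated_path :: "real \<Rightarrow> (real \<Rightarrow> real ^ 'm) \<Rightarrow> real \<Rightarrow> real \<Rightarrow> real ^ 'm" where
  "interpolated_path T W \<rho> t =
     (let \<tau> = real (coarse_steps \<rho>) * \<rho>;
          k = real_of_int \<lfloor>t / \<tau>\<rfloor>;
          Wext = (\<lambda>r. W (min r T))
      in Wext (k * \<tau>) + ((t - k * \<tau>) / \<tau>) *\<^sub>R (Wext ((k + 1) * \<tau>) - Wext (k * \<tau>)))"

definition grid_time :: "real \<Rightarrow> real \<Rightarrow> nat \<Rightarrow> real" where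
  "grid_time T \<rho> n = min (real n * \<rho>) T"

definition grid_size :: "real \<Rightarrow> real \<Rightarrow> nat" where
  "grid_size T \<rho> = (LEAST N. grid_time T \<rho> N = T)"

definition scheme_solution ::
    "(real \<Rightarrow> real \<Rightarrow> real \<Rightarrow> (real \<Rightarrow> real ^ 'm) \<Rightarrow> (real ^ 'd \<Rightarrow> real) \<Rightarrow> (real ^ 'd \<Rightarrow> real)) \<Rightarrow>
     real \<Rightarrow> (real \<Rightarrow> real ^ 'm) \<Rightarrow> (real ^ 'd \<Rightarrow> real) \<Rightarrow> real \<Rightarrow> real \<Rightarrow>
     (real \<Rightarrow> real ^ 'd \<Rightarrow> real) \<Rightarrow> bool" where
  "scheme_solution S T W u0 h \<rho> uh \<longleftrightarrow>
     uh 0 = u0 \<and>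
     (\<forall>n < grid_size T \<rho>. \<forall>t \<in> {grid_time T \<rho> n <.. grid_time T \<rho> (Suc n)}.
        uh t = S h t (grid_time T \<rho> n) (interpolated_path T W \<rho>) (uh (grid_time T \<rho> n)))"

end

theory Submission
  imports Defs
begin

text \<open>
  The penalty of the doubling of variables is chosen so that it stays smooth under both paths. For
  \<open>\<bar>\<eta>\<bar> \<le> \<kappa>\<close> the function \<open>\<kappa> \<Sum>\<^sub>i (H\<^sub>1\<^sup>i + H\<^sub>2\<^sup>i) - \<eta> \<cdot> H = \<Sum>\<^sub>i (\<kappa> - \<eta>\<^sub>i) H\<^sub>1\<^sup>i + (\<kappa> + \<eta>\<^sub>i) H\<^sub>2\<^sup>i\<close> is convex, so
  \<open>V(\<eta>, z) = sup {p \<cdot> z - \<delta>\<bar>p\<bar>\<^sup>2/2 - \<kappa> \<Sum>\<^sub>i (H\<^sub>1\<^sup>i + H\<^sub>2\<^sup>i)(p) + \<eta> \<cdot> H(p) : \<bar>p\<bar> \<le> L}\<close> has a unique maximiser \<open>D\<^sub>zV\<close>,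
  which is Lipschitz in \<open>z\<close> with constant of order \<open>1/\<delta>\<close>; by the envelope theorem \<open>V(\<zeta>(t), x)\<close> solves
  the equation driven by \<open>\<zeta>\<close>. With \<open>\<delta>\<close> and \<open>\<kappa>\<close> of the order \<open>\<omega>(\<rho>\<^sup>1\<^sup>/\<^sup>2)\<close>, the bound
  \<open>u\<^sub>h(x, t\<^sub>n) - u(y, t\<^sub>n) \<le> A + n E + V((W\<^sub>h - W)(t\<^sub>n), x - y)\<close> propagates: monotonicity and consistency of the
  scheme move \<open>W\<^sub>h\<close> from \<open>t\<^sub>n\<close> to \<open>t\<^sub>n\<^sub>+\<^sub>1\<close> for fixed \<open>y\<close>, at the cost of \<open>E\<close> of order \<open>h\<^sup>2/\<delta>\<close>; then comparing \<open>u\<close>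
  with a smooth solution for fixed \<open>x\<close> moves \<open>W\<close>. Finally \<open>V(\<eta>, 0) \<le> 0\<close> since \<open>H\<^sub>1, H\<^sub>2 \<ge> 0\<close>, and
  the number of steps is at most \<open>(1 + T)/\<rho>\<close>.
\<close>

section \<open>Legendre transforms of strongly convex functions on a ball\<close>

definition penalized :: "real \<Rightarrow> ('a::euclidean_space \<Rightarrow> real) \<Rightarrow> 'a \<Rightarrow> 'a \<Rightarrow> real" where
  "penalized \<delta> k z p = p \<bullet> z - \<delta> / 2 * (norm p)\<^sup>2 - k p"

text \<open>For convex \<open>k\<close> and \<delta> > 0 strict concavity makes the maximiser
  unique, so the choice is harmless. The radius \<open>L\<close> admits exactly the slopes that a
  function with Lipschitz constant \<open>L\<close> can have.\<close>

definition legmax :: "real \<Rightarrow> real \<Rightarrow> ('a::euclidean_space \<Rightarrow> real) \<Rightarrow> 'a \<Rightarrow> 'a" where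
  "legmax L \<delta> k z =
     (SOME p. p \<in> cball 0 L \<and> (\<forall>q\<in>cball 0 L. penalized \<delta> k z q \<le> penalized \<delta> k z p))"

definition legendre :: "real \<Rightarrow> real \<Rightarrow> ('a::euclidean_space \<Rightarrow> real) \<Rightarrow> 'a \<Rightarrow> real" where
  "legendre L \<delta> k z = penalized \<delta> k z (legmax L \<delta> k z)"

text \<open>Finite convex functions on a Euclidean space are continuous, so by compactness of the
  ball the choice in \<open>legmax\<close> picks an actual maximiser.\<close>

lemma
  assumes "0 \<le> L" and "convex_on UNIV k"
  shows norm_legmax_le: "norm (legmax L \<delta> k z) \<le> L"
    and penalized_le_legendre: "norm q \<le> L \<Longrightarrow> penalized \<delta> k z q \<le> legendre L \<delta> k z"
proof -
  have "continuous_on UNIV k"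
    using assms(2) by (intro convex_on_continuous) auto
  then have "continuous_on (cball 0 L) k"
    by (rule continuous_on_subset) simp
  then have "continuous_on (cball 0 L) (penalized \<delta> k z)"
    unfolding penalized_def by (intro continuous_intros)
  then have ex: "\<exists>p\<in>cball 0 L. \<forall>q\<in>cball 0 L. penalized \<delta> k z q \<le> penalized \<delta> k z p"
    using assms(1) by (intro continuous_attains_sup) auto
  have *: "legmax L \<delta> k z \<in> cball 0 L \<and>
      (\<forall>q\<in>cball 0 L. penalized \<delta> k z q \<le> penalized \<delta> k z (legmax L \<delta> k z))"
    unfolding legmax_def by (rule someI_ex) (use ex in auto)
  then show "norm (legmax L \<delta> k z) \<le> L" by simp
  show "penalized \<delta> k z q \<le> legendre L \<delta> k z" if "norm q \<le> L"
    using * that by (auto simp: legendre_def)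
qed

text \<open>The midpoint of the maximiser and \<open>q\<close> is a competitor: convexity of
  \<open>k\<close> and the parallelogram identity gain
  \<open>\<delta> / 8 * (norm (p - q))^2\<close> there, and doubling gives the constant
  \<delta>/4.\<close>

lemma legendre_gap:
  assumes "0 \<le> L" and "convex_on UNIV k" and "norm q \<le> L"
  shows "penalized \<delta> k z q + \<delta> / 4 * (norm (legmax L \<delta> k z - q))\<^sup>2 \<le> legendre L \<delta> k z"
proof -
  define p where "p = legmax L \<delta> k z"
  define m where "m = (1/2) *\<^sub>R p + (1/2) *\<^sub>R q"
  have "norm p \<le> L" using norm_legmax_le assms p_def by blast
  then have "norm m \<le> L"
    unfolding m_def using assms(3) by (intro norm_triangle_le) simp
  then have "penalized \<delta> k z m \<le> legendre L \<delta> k z"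
    using penalized_le_legendre assms by blast
  moreover have "k m \<le> (1/2) * k p + (1/2) * k q"
    using convex_onD[OF assms(2), of "1/2" p q] by (simp add: m_def)
  moreover have "m \<bullet> z = (1/2) * (p \<bullet> z) + (1/2) * (q \<bullet> z)"
    by (simp add: m_def inner_add_left)
  moreover have "(norm m)\<^sup>2 = 1/2 * (norm p)\<^sup>2 + 1/2 * (norm q)\<^sup>2 - 1/4 * (norm (p - q))\<^sup>2"
    by (simp add: m_def power2_norm_eq_inner inner_add_left inner_add_right inner_diff_left
        inner_diff_right inner_commute[of q p] field_simps)
  then have "\<delta> / 2 * (norm m)\<^sup>2 =
      \<delta> / 4 * (norm p)\<^sup>2 + \<delta> / 4 * (norm q)\<^sup>2 - \<delta> / 8 * (norm (p - q))\<^sup>2"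
    by (simp add: right_diff_distrib distrib_left)
  ultimately show ?thesis
    unfolding penalized_def legendre_def p_def[symmetric] by linarith
qed

text \<open>Each maximiser competes in the other problem. Adding the two gap inequalities cancels
  the quadratic penalties and leaves the cross term plus at most \<open>2 * e\<close> from
  exchanging \<open>k\<close> and \<open>k'\<close>.\<close>

lemma legmax_stability:
  fixes z z' :: "'a::euclidean_space" and \<delta> :: real
  assumes "0 \<le> L" and "convex_on UNIV k" and "convex_on UNIV k'"
    and e: "\<And>p. norm p \<le> L \<Longrightarrow> \<bar>k p - k' p\<bar> \<le> e"
  defines "P \<equiv> legmax L \<delta> k z" and "P' \<equiv> legmax L \<delta> k' z'"
  shows "\<delta> / 2 * (norm (P - P'))\<^sup>2 \<le> (z - z') \<bullet> (P - P') + 2 * e"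
proof -
  have P: "norm P \<le> L" "norm P' \<le> L"
    unfolding P_def P'_def using norm_legmax_le assms by blast+
  have "penalized \<delta> k z P' + \<delta> / 4 * (norm (P - P'))\<^sup>2 \<le> penalized \<delta> k z P"
    using legendre_gap[OF assms(1,2) P(2)] by (simp add: legendre_def P_def)
  moreover have "penalized \<delta> k' z' P + \<delta> / 4 * (norm (P' - P))\<^sup>2 \<le> penalized \<delta> k' z' P'"
    using legendre_gap[OF assms(1,3) P(1)] by (simp add: legendre_def P'_def)
  ultimately show ?thesis
    using e[OF P(1)] e[OF P(2)] unfolding penalized_def norm_minus_commute[of P' P]
    by (simp add: inner_commute[of P] inner_commute[of P'] inner_diff_left inner_diff_right)
qed

text \<open>The maximiser of the second problem competes in the first. With the roles exchanged this
  also gives an upper bound, so differences of transforms get squeezed.\<close>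

lemma legendre_diff_ge:
  assumes "0 \<le> L" and "convex_on UNIV k" and "convex_on UNIV k'"
  shows "legendre L \<delta> k z - legendre L \<delta> k' z'
      \<ge> legmax L \<delta> k' z' \<bullet> (z - z') - (k (legmax L \<delta> k' z') - k' (legmax L \<delta> k' z'))"
proof -
  have "penalized \<delta> k z (legmax L \<delta> k' z') \<le> legendre L \<delta> k z"
    using assms by (intro penalized_le_legendre norm_legmax_le)
  then show ?thesis
    by (simp add: penalized_def legendre_def inner_diff_right)
qed

text \<open>Envelope theorem: by \<open>legendre_diff_ge\<close> in both directions the remainder of
  the linearisation lies between 0 and \<open>(y - z) \<bullet> (P y - P z)\<close>, which is
  quadratic because \<open>P\<close> has Lipschitz constant 2/\<delta>.\<close>

lemma GDERIV_legendre:
  assumes "0 \<le> L" and "convex_on UNIV k" and "0 < \<delta>"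
  shows "GDERIV (legendre L \<delta> k) z :> legmax L \<delta> k z"
proof -
  define P where "P = legmax L \<delta> k"
  have lip: "norm (P y - P z) \<le> 2 / \<delta> * norm (y - z)" for y
  proof -
    have "\<delta> / 2 * (norm (P y - P z))\<^sup>2 \<le> (y - z) \<bullet> (P y - P z)"
      using legmax_stability[of L k k 0 \<delta> y z] assms by (simp add: P_def)
    also have "\<dots> \<le> norm (y - z) * norm (P y - P z)"
      by (rule norm_cauchy_schwarz)
    finally show ?thesis
      using assms(3) by (cases "norm (P y - P z) = 0") (auto simp: power2_eq_square field_simps)
  qed
  have "\<bar>legendre L \<delta> k y - legendre L \<delta> k z - (y - z) \<bullet> P z\<bar> \<le> 2 / \<delta> * (norm (y - z))\<^sup>2" for y
  proof -
    have "0 \<le> legendre L \<delta> k y - legendre L \<delta> k z - (y - z) \<bullet> P z"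
      using legendre_diff_ge[OF assms(1,2,2), where z = y and z' = z and \<delta> = \<delta>]
      by (simp add: P_def inner_commute)
    moreover have "legendre L \<delta> k y - legendre L \<delta> k z - (y - z) \<bullet> P z \<le> (y - z) \<bullet> (P y - P z)"
      using legendre_diff_ge[OF assms(1,2,2), where z = z and z' = y and \<delta> = \<delta>]
      by (simp add: P_def inner_commute inner_diff_left inner_diff_right)
    moreover have "(y - z) \<bullet> (P y - P z) \<le> norm (y - z) * norm (P y - P z)"
      by (rule norm_cauchy_schwarz)
    moreover have "norm (y - z) * norm (P y - P z) \<le> norm (y - z) * (2 / \<delta> * norm (y - z))"
      by (intro mult_left_mono lip) auto
    moreover have "norm (y - z) * (2 / \<delta> * norm (y - z)) = 2 / \<delta> * (norm (y - z))\<^sup>2"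
      by (simp add: power2_eq_square)
    ultimately show ?thesis by linarith
  qed
  then have *: "norm (legendre L \<delta> k y - legendre L \<delta> k z - (y - z) \<bullet> P z) / norm (y - z)
      \<le> 2 / \<delta> * norm (y - z)" for y
    by (cases "y = z") (auto simp: field_simps power2_eq_square)
  have "(legendre L \<delta> k has_derivative (\<lambda>h. h \<bullet> P z)) (at z)"
    unfolding has_derivative_iff_norm
  proof
    show "bounded_linear (\<lambda>h. h \<bullet> P z)" by (rule bounded_linear_inner_left)
    show "((\<lambda>y. norm (legendre L \<delta> k y - legendre L \<delta> k z - (y - z) \<bullet> P z) / norm (y - z)) \<longlongrightarrow> 0) (at z)"
      by (rule Lim_null_comparison[where g="\<lambda>y. 2 / \<delta> * norm (y - z)"])
        (use * assms(3) in \<open>auto intro!: tendsto_eq_intros\<close>)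
  qed
  then show ?thesis by (simp add: gderiv_def P_def)
qed

section \<open>Auxiliary facts on gradients, a quadratic inequality and convex sums\<close>

lemma grad_eqI:
  assumes "GDERIV f x :> D"
  shows "grad f x = D"
  unfolding grad_def
proof (rule the_equality)
  fix E assume "GDERIV f x :> E"
  then have "(\<lambda>h. h \<bullet> E) = (\<lambda>h. h \<bullet> D)"
    using assms unfolding gderiv_def by (rule has_derivative_unique)
  then show "E = D" using vector_eq_ldot by metis
qed (rule assms)

text \<open>Solves the quadratic inequality that the stability of maximisers yields for their
  distance.\<close>

lemma le_add_sqrt_if_square_le:
  fixes X :: real
  assumes "0 \<le> X" and "0 \<le> a" and "0 \<le> e" and "X\<^sup>2 \<le> a * X + e"
  shows "X \<le> a + sqrt e"
proof (rule ccontr)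
  assume "\<not> ?thesis"
  then have "sqrt e < X - a" and "sqrt e < X" using assms by auto
  then have "sqrt e * sqrt e < X * (X - a)"
    using assms(3) by (intro mult_strict_mono') auto
  with assms show False by (simp add: power2_eq_square algebra_simps)
qed

lemma convex_on_fun_sum:
  assumes "finite A" and "\<And>i. i \<in> A \<Longrightarrow> convex_on UNIV (f i)"
  shows "convex_on UNIV (\<lambda>x. \<Sum>i\<in>A. f i x)"
  using assms by (induction A rule: finite_induct) (auto intro!: convex_on_add simp: convex_on_const)

lemma lipschitz_in_UC:
  assumes "K-lipschitz_on UNIV w"
  shows "w \<in> UC"
  using lipschitz_on_uniformly_continuous[OF assms] by (simp add: UC_def)

section \<open>Explicit smooth solutions\<close>

text \<open>All gradients of the test functions lie in the ball of radius \<open>L\<close>, so it is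
  enough to bound the Hamiltonian there, with one constant \<open>B\<close> for both bounds.\<close>

locale dc_hamiltonian =
  fixes H H1 H2 :: "real ^ 'd \<Rightarrow> real ^ 'm" and L B :: real
  assumes L_pos: "0 < L"
    and H_eq: "H p = H1 p - H2 p"
    and convex_H1: "convex_on UNIV (\<lambda>p. H1 p $ i)"
    and convex_H2: "convex_on UNIV (\<lambda>p. H2 p $ i)"
    and H1_nonneg: "0 \<le> H1 p $ i"
    and H2_nonneg: "0 \<le> H2 p $ i"
    and H_bound: "norm p \<le> L \<Longrightarrow> norm (H p) \<le> B"
    and H_sum_bound: "norm p \<le> L \<Longrightarrow> (\<Sum>i\<in>UNIV. H1 p $ i + H2 p $ i) \<le> B"
    and continuous_H: "continuous_on UNIV H"
begin

section \<open>The convexified potential and its transform in both variables\<close>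

definition pot :: "real \<Rightarrow> real ^ 'm \<Rightarrow> real ^ 'd \<Rightarrow> real" where
  "pot \<kappa> \<eta> p = \<kappa> * (\<Sum>i\<in>UNIV. H1 p $ i + H2 p $ i) - \<eta> \<bullet> H p"

text \<open>The minus sign in \<open>pot\<close> makes the derivative of \<open>V\<close> in \<eta>
  equal to \<open>+ H\<close> at the maximiser; this is the equation, with \<eta> as the driving
  path.\<close>

definition V :: "real \<Rightarrow> real \<Rightarrow> real ^ 'm \<Rightarrow> real ^ 'd \<Rightarrow> real" where
  "V \<delta> \<kappa> \<eta> = legendre L \<delta> (pot \<kappa> \<eta>)"

definition G :: "real \<Rightarrow> real \<Rightarrow> real ^ 'm \<Rightarrow> real ^ 'd \<Rightarrow> real ^ 'd" where
  "G \<delta> \<kappa> \<eta> = legmax L \<delta> (pot \<kappa> \<eta>)"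

lemma B_nonneg: "0 \<le> B"
  using order_trans[OF norm_ge_zero H_bound, of 0] L_pos by simp

lemma pot_eq:
  "pot \<kappa> \<eta> p = (\<Sum>i\<in>UNIV. (\<kappa> - \<eta> $ i) * H1 p $ i + (\<kappa> + \<eta> $ i) * H2 p $ i)"
  unfolding pot_def inner_vec_def sum_distrib_left sum_subtractf[symmetric]
  by (intro sum.cong) (auto simp: H_eq algebra_simps)

lemma
  assumes "norm \<eta> \<le> \<kappa>"
  shows convex_pot: "convex_on UNIV (pot \<kappa> \<eta>)"
    and pot_nonneg: "0 \<le> pot \<kappa> \<eta> p"
proof -
  have "\<bar>\<eta> $ i\<bar> \<le> \<kappa>" for i
    using component_le_norm_cart[of \<eta> i] assms by auto
  then have *: "0 \<le> \<kappa> - \<eta> $ i" "0 \<le> \<kappa> + \<eta> $ i" for i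
    by (smt (verit))+
  show "convex_on UNIV (pot \<kappa> \<eta>)"
    unfolding pot_eq using *
    by (intro convex_on_fun_sum convex_on_add convex_on_cmul convex_H1 convex_H2 finite)
  show "0 \<le> pot \<kappa> \<eta> p"
    unfolding pot_eq using * H1_nonneg H2_nonneg by (simp add: sum_nonneg)
qed

lemma pot_diff_le:
  assumes "norm p \<le> L"
  shows "\<bar>pot \<kappa> \<eta> p - pot \<kappa> \<eta>' p\<bar> \<le> B * norm (\<eta> - \<eta>')"
proof -
  have "\<bar>pot \<kappa> \<eta> p - pot \<kappa> \<eta>' p\<bar> = \<bar>(\<eta> - \<eta>') \<bullet> H p\<bar>"
    by (simp add: pot_def inner_diff_left)
  also have "\<dots> \<le> norm (\<eta> - \<eta>') * norm (H p)" by (rule Cauchy_Schwarz_ineq2)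
  also have "\<dots> \<le> B * norm (\<eta> - \<eta>')"
    using H_bound[OF assms] by (subst mult.commute) (intro mult_right_mono, auto)
  finally show ?thesis .
qed

lemma norm_G_le: "norm \<eta> \<le> \<kappa> \<Longrightarrow> norm (G \<delta> \<kappa> \<eta> z) \<le> L"
  unfolding G_def using L_pos convex_pot by (intro norm_legmax_le) auto

text \<open>The dependence on \<eta> is only Hoelder of order 1/2: a perturbation of the potential
  enters \<open>legmax_stability\<close> without a factor \<open>norm (P - P')\<close>. This still
  suffices for continuity and for limits along approximating paths.\<close>

lemma G_diff_le:
  assumes "norm \<eta> \<le> \<kappa>" and "norm \<eta>' \<le> \<kappa>" and "0 < \<delta>"
  shows "norm (G \<delta> \<kappa> \<eta> z - G \<delta> \<kappa> \<eta>' z')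
      \<le> 2 / \<delta> * norm (z - z') + sqrt (4 * B / \<delta> * norm (\<eta> - \<eta>'))"
proof (rule le_add_sqrt_if_square_le)
  let ?D = "G \<delta> \<kappa> \<eta> z - G \<delta> \<kappa> \<eta>' z'"
  have "\<delta> / 2 * (norm ?D)\<^sup>2 \<le> (z - z') \<bullet> ?D + 2 * (B * norm (\<eta> - \<eta>'))"
    unfolding G_def using L_pos convex_pot assms pot_diff_le by (intro legmax_stability) auto
  also have "(z - z') \<bullet> ?D \<le> norm (z - z') * norm ?D"
    by (rule norm_cauchy_schwarz)
  finally show "(norm ?D)\<^sup>2 \<le> 2 / \<delta> * norm (z - z') * norm ?D + 4 * B / \<delta> * norm (\<eta> - \<eta>')"
    using assms(3) by (simp add: field_simps)
qed (use assms B_nonneg in auto)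

text \<open>For fixed \<open>p\<close> the penalised expression is affine in (\<eta>, z), so
  \<open>V\<close> is a supremum of affine functions and the maximiser supplies the subgradient
  \<open>(H (G ...), G ...)\<close>.\<close>

lemma V_diff_ge:
  assumes "norm \<eta> \<le> \<kappa>" and "norm \<eta>' \<le> \<kappa>"
  shows "V \<delta> \<kappa> \<eta> z - V \<delta> \<kappa> \<eta>' z'
      \<ge> G \<delta> \<kappa> \<eta>' z' \<bullet> (z - z') + (\<eta> - \<eta>') \<bullet> H (G \<delta> \<kappa> \<eta>' z')"
  using legendre_diff_ge[of L "pot \<kappa> \<eta>" "pot \<kappa> \<eta>'" \<delta> z' z] L_pos convex_pot[OF assms(1)] convex_pot[OF assms(2)]
  by (simp add: V_def G_def) (simp add: pot_def inner_diff_left)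

lemma V_diff_le:
  assumes "norm \<eta> \<le> \<kappa>" and "norm \<eta>' \<le> \<kappa>"
  shows "\<bar>V \<delta> \<kappa> \<eta> z - V \<delta> \<kappa> \<eta>' z'\<bar> \<le> L * norm (z - z') + B * norm (\<eta> - \<eta>')"
proof -
  have *: "V \<delta> \<kappa> \<eta> z - V \<delta> \<kappa> \<eta>' z' \<ge> - (L * norm (z - z') + B * norm (\<eta> - \<eta>'))"
    if "norm \<eta> \<le> \<kappa>" and "norm \<eta>' \<le> \<kappa>" for \<eta> \<eta>' z z'
  proof -
    let ?p = "G \<delta> \<kappa> \<eta>' z'"
    have p: "norm ?p \<le> L" using norm_G_le that by auto
    have "\<bar>?p \<bullet> (z - z')\<bar> \<le> L * norm (z - z')"
      using Cauchy_Schwarz_ineq2 by (rule order_trans) (intro mult_right_mono p, auto)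
    moreover have "\<bar>(\<eta> - \<eta>') \<bullet> H ?p\<bar> \<le> B * norm (\<eta> - \<eta>')"
      using Cauchy_Schwarz_ineq2
      by (rule order_trans) (subst mult.commute, intro mult_right_mono H_bound p, auto)
    ultimately show ?thesis
      using V_diff_ge[OF that, of \<delta> z' z] by linarith
  qed
  show ?thesis
    using *[OF assms, of z z'] *[OF assms(2,1), of z' z]
    by (auto simp: norm_minus_commute abs_le_iff)
qed

text \<open>Serves twice: it dominates the initial data, and its linear growth confines maxima to a
  compact set. The term \<open>2 * \<kappa> * B\<close> collects \<open>\<kappa> * B\<close> from
  each of the two summands of \<open>pot\<close>.\<close>

lemma V_ge:
  assumes "norm \<eta> \<le> \<kappa>" and "0 \<le> \<delta>"
  shows "V \<delta> \<kappa> \<eta> z \<ge> L * norm z - \<delta> / 2 * L\<^sup>2 - 2 * \<kappa> * B"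
proof -
  \<comment> \<open>The slope of length \<open>L\<close> in the direction of \<open>z\<close>. At
    \<open>z = 0\<close> division by zero yields \<open>p = 0\<close>, for which both claims below
    remain true.\<close>
  define p where "p = (L / norm z) *\<^sub>R z"
  have p: "norm p \<le> L" "p \<bullet> z = L * norm z"
    using L_pos by (auto simp: p_def power2_norm_eq_inner[symmetric] power2_eq_square)
  have "0 \<le> \<kappa>" using assms(1) norm_ge_zero order_trans by blast
  have "penalized \<delta> (pot \<kappa> \<eta>) z p \<le> V \<delta> \<kappa> \<eta> z"
    unfolding V_def using L_pos convex_pot assms p by (intro penalized_le_legendre) auto
  moreover have "\<delta> / 2 * (norm p)\<^sup>2 \<le> \<delta> / 2 * L\<^sup>2"
    using assms p by (intro mult_left_mono power_mono) auto
  moreover have "\<bar>\<eta> \<bullet> H p\<bar> \<le> \<kappa> * B"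
    using Cauchy_Schwarz_ineq2
    by (rule order_trans) (intro mult_mono assms H_bound p \<open>0 \<le> \<kappa>\<close> norm_ge_zero)
  moreover have "\<kappa> * (\<Sum>i\<in>UNIV. H1 p $ i + H2 p $ i) \<le> \<kappa> * B"
    using \<open>0 \<le> \<kappa>\<close> p by (intro mult_left_mono H_sum_bound)
  ultimately show ?thesis
    unfolding penalized_def pot_def p(2) by linarith
qed

lemma V_zero_le:
  assumes "norm \<eta> \<le> \<kappa>" and "0 \<le> \<delta>"
  shows "V \<delta> \<kappa> \<eta> 0 \<le> 0"
proof -
  have "0 \<le> pot \<kappa> \<eta> p + \<delta> * (norm p)\<^sup>2 / 2" for p
    using pot_nonneg[OF assms(1)] assms(2) by simp
  from this[of "legmax L \<delta> (pot \<kappa> \<eta>) 0"] show ?thesis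
    by (simp add: V_def legendre_def penalized_def)
qed

lemma GDERIV_V:
  assumes "norm \<eta> \<le> \<kappa>" and "0 < \<delta>"
  shows "GDERIV (V \<delta> \<kappa> \<eta>) z :> G \<delta> \<kappa> \<eta> z"
  unfolding V_def G_def using L_pos convex_pot assms by (intro GDERIV_legendre) auto

lemma
  assumes "0 < \<delta>"
  shows continuous_on_V: "continuous_on ({\<eta>. norm \<eta> \<le> \<kappa>} \<times> UNIV) (\<lambda>(\<eta>, z). V \<delta> \<kappa> \<eta> z)"
    and continuous_on_G: "continuous_on ({\<eta>. norm \<eta> \<le> \<kappa>} \<times> UNIV) (\<lambda>(\<eta>, z). G \<delta> \<kappa> \<eta> z)"
proof -
  let ?S = "{\<eta> :: real ^ 'm. norm \<eta> \<le> \<kappa>} \<times> (UNIV :: (real ^ 'd) set)"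
  have S: "\<forall>\<^sub>F w in at v within ?S. w \<in> ?S" for v
    by (simp add: eventually_at_filter)
  show "continuous_on ?S (\<lambda>(\<eta>, z). V \<delta> \<kappa> \<eta> z)"
    unfolding continuous_on_def
  proof (rule ballI, rule LIM_zero_cancel, rule Lim_null_comparison)
    fix v assume v: "v \<in> ?S"
    show "\<forall>\<^sub>F w in at v within ?S. norm ((case w of (\<eta>, z) \<Rightarrow> V \<delta> \<kappa> \<eta> z) - (case v of (\<eta>, z) \<Rightarrow> V \<delta> \<kappa> \<eta> z))
        \<le> L * norm (snd w - snd v) + B * norm (fst w - fst v)"
      using S by eventually_elim (use v V_diff_le in auto)
    show "((\<lambda>w. L * norm (snd w - snd v) + B * norm (fst w - fst v)) \<longlongrightarrow> 0) (at v within ?S)"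
      by (auto intro!: tendsto_eq_intros)
  qed
  show "continuous_on ?S (\<lambda>(\<eta>, z). G \<delta> \<kappa> \<eta> z)"
    unfolding continuous_on_def
  proof (rule ballI, rule LIM_zero_cancel, rule Lim_null_comparison)
    fix v assume v: "v \<in> ?S"
    show "\<forall>\<^sub>F w in at v within ?S. norm ((case w of (\<eta>, z) \<Rightarrow> G \<delta> \<kappa> \<eta> z) - (case v of (\<eta>, z) \<Rightarrow> G \<delta> \<kappa> \<eta> z))
        \<le> 2 / \<delta> * norm (snd w - snd v) + sqrt (4 * B / \<delta> * norm (fst w - fst v))"
      using S by eventually_elim (use v G_diff_le[OF _ _ assms] in auto)
    show "((\<lambda>w. 2 / \<delta> * norm (snd w - snd v) + sqrt (4 * B / \<delta> * norm (fst w - fst v))) \<longlongrightarrow> 0) (at v within ?S)"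
      using assms by (auto intro!: tendsto_eq_intros)
  qed
qed

text \<open>Envelope theorem in time. The remainder lies between 0 and
  \<open>(\<eta> r - \<eta> t) \<bullet> (w r - w t)\<close>; the first factor is of order
  \<open>r - t\<close> and the second tends to 0 by continuity of \<open>G\<close>, so Hoelder
  continuity of \<open>G\<close> is enough.\<close>

lemma V_has_derivative_path:
  assumes \<eta>: "(\<eta> has_vector_derivative D) (at t within I)" and t: "t \<in> I"
    and bd: "\<And>r. r \<in> I \<Longrightarrow> norm (\<eta> r) \<le> \<kappa>" and "0 < \<delta>"
  shows "((\<lambda>r. V \<delta> \<kappa> (\<eta> r) z) has_real_derivative D \<bullet> H (G \<delta> \<kappa> (\<eta> t) z)) (at t within I)"
proof -
  define w where "w r = H (G \<delta> \<kappa> (\<eta> r) z)" for r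
  define rem where "rem r = V \<delta> \<kappa> (\<eta> r) z - V \<delta> \<kappa> (\<eta> t) z - (\<eta> r - \<eta> t) \<bullet> w t" for r
  define q where "q r = norm (\<eta> r - \<eta> t - (r - t) *\<^sub>R D) / norm (r - t)" for r
  have in_I: "\<forall>\<^sub>F r in at t within I. r \<in> I \<and> r \<noteq> t"
    by (simp add: eventually_at_filter)
  have q: "(q \<longlongrightarrow> 0) (at t within I)"
    using \<eta> unfolding q_def has_vector_derivative_def has_derivative_iff_norm by simp
  have cont_\<eta>: "(\<eta> \<longlongrightarrow> \<eta> t) (at t within I)"
    using has_vector_derivative_continuous[OF \<eta>] by (simp add: continuous_within)
  have "((\<lambda>r. G \<delta> \<kappa> (\<eta> r) z) \<longlongrightarrow> G \<delta> \<kappa> (\<eta> t) z) (at t within I)"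
  proof (rule LIM_zero_cancel, rule Lim_null_comparison)
    show "\<forall>\<^sub>F r in at t within I. norm (G \<delta> \<kappa> (\<eta> r) z - G \<delta> \<kappa> (\<eta> t) z) \<le> sqrt (4 * B / \<delta> * norm (\<eta> r - \<eta> t))"
      using in_I
    proof eventually_elim
      case (elim r)
      then show ?case
        using G_diff_le[OF bd bd[OF t] \<open>0 < \<delta>\<close>, of r z z] by simp
    qed
    show "((\<lambda>r. sqrt (4 * B / \<delta> * norm (\<eta> r - \<eta> t))) \<longlongrightarrow> 0) (at t within I)"
      using cont_\<eta> \<open>0 < \<delta>\<close> by (auto intro!: tendsto_eq_intros)
  qed
  then have w: "(w \<longlongrightarrow> w t) (at t within I)"
    unfolding w_def using continuous_H
    by (intro isCont_tendsto_compose[of _ H]) (auto simp: continuous_on_eq_continuous_at)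
  have "((\<lambda>r. rem r / (r - t)) \<longlongrightarrow> 0) (at t within I)"
  proof (rule Lim_null_comparison)
    show "\<forall>\<^sub>F r in at t within I. norm (rem r / (r - t)) \<le> (q r + norm D) * norm (w r - w t)"
      using in_I
    proof eventually_elim
      case (elim r)
      have "0 \<le> rem r"
        using V_diff_ge[OF bd bd[OF t], of r \<delta> z z] elim by (simp add: rem_def w_def)
      moreover have "rem r \<le> (\<eta> r - \<eta> t) \<bullet> (w r - w t)"
        using V_diff_ge[OF bd[OF t] bd, of r \<delta> z z] elim
        by (simp add: rem_def w_def inner_diff_left inner_diff_right)
      moreover have "(\<eta> r - \<eta> t) \<bullet> (w r - w t) \<le> norm (\<eta> r - \<eta> t) * norm (w r - w t)"
        by (rule norm_cauchy_schwarz)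
      ultimately have "\<bar>rem r\<bar> \<le> norm (\<eta> r - \<eta> t) * norm (w r - w t)" by simp
      then have "norm (rem r / (r - t)) \<le> norm (\<eta> r - \<eta> t) / norm (r - t) * norm (w r - w t)"
        by (simp add: divide_right_mono)
      also have "norm (\<eta> r - \<eta> t) \<le> norm (\<eta> r - \<eta> t - (r - t) *\<^sub>R D) + norm (r - t) * norm D"
        using norm_triangle_sub[of "\<eta> r - \<eta> t" "(r - t) *\<^sub>R D"] by simp
      then have "norm (\<eta> r - \<eta> t) / norm (r - t) \<le> q r + norm D"
        using elim by (simp add: q_def field_simps)
      then have "norm (\<eta> r - \<eta> t) / norm (r - t) * norm (w r - w t) \<le> (q r + norm D) * norm (w r - w t)"
        by (intro mult_right_mono) auto
      finally show ?case .
    qed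
    show "((\<lambda>r. (q r + norm D) * norm (w r - w t)) \<longlongrightarrow> 0) (at t within I)"
      using q w by (auto intro!: tendsto_eq_intros)
  qed
  moreover have "((\<lambda>r. \<eta> r \<bullet> w t) has_real_derivative D \<bullet> w t) (at t within I)"
    using bounded_linear.has_vector_derivative[OF bounded_linear_inner_left \<eta>]
    by (simp add: has_real_derivative_iff_has_vector_derivative)
  then have "((\<lambda>r. (\<eta> r - \<eta> t) \<bullet> w t / (r - t)) \<longlongrightarrow> D \<bullet> w t) (at t within I)"
    by (simp add: has_field_derivative_iff inner_diff_left)
  ultimately have "((\<lambda>r. rem r / (r - t) + (\<eta> r - \<eta> t) \<bullet> w t / (r - t)) \<longlongrightarrow> 0 + D \<bullet> w t) (at t within I)"
    by (rule tendsto_add)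
  then show ?thesis
    unfolding has_field_derivative_iff w_def[symmetric]
    by (simp add: rem_def add_divide_distrib[symmetric])
qed

text \<open>
  The sign \<open>\<sigma>\<close> selects a test function from above (\<open>\<sigma> = 1\<close>) or from below (\<open>\<sigma> = -1\<close>), so that both
  one-sided estimates have the same proof.
\<close>

definition test :: "real \<Rightarrow> real \<Rightarrow> real \<Rightarrow> real ^ 'm \<Rightarrow> (real \<Rightarrow> real ^ 'm) \<Rightarrow> real ^ 'd \<Rightarrow>
    real \<Rightarrow> real ^ 'd \<Rightarrow> real" where
  "test \<sigma> \<delta> \<kappa> c \<zeta> y r x = \<sigma> * V \<delta> \<kappa> (\<sigma> *\<^sub>R (\<zeta> r - c)) (\<sigma> *\<^sub>R (x - y))"

section \<open>The test functions solve the equation driven by a continuous path\<close>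

context
  fixes \<sigma> \<delta> :: real
  assumes \<sigma>: "\<sigma> = 1 \<or> \<sigma> = - 1" and \<delta>: "0 < \<delta>"
begin

text \<open>The sign outside \<open>V\<close> and the sign inside its spatial argument multiply to
  1, so the gradient is \<open>G\<close> itself for either \<sigma>.\<close>

lemma grad_test:
  assumes "norm (\<zeta> r - c) \<le> \<kappa>"
  shows "GDERIV (test \<sigma> \<delta> \<kappa> c \<zeta> y r) x :> G \<delta> \<kappa> (\<sigma> *\<^sub>R (\<zeta> r - c)) (\<sigma> *\<^sub>R (x - y))"
    and "grad (test \<sigma> \<delta> \<kappa> c \<zeta> y r) x = G \<delta> \<kappa> (\<sigma> *\<^sub>R (\<zeta> r - c)) (\<sigma> *\<^sub>R (x - y))"
proof -
  have "norm (\<sigma> *\<^sub>R (\<zeta> r - c)) \<le> \<kappa>"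
    using assms \<sigma> by auto
  then have "(V \<delta> \<kappa> (\<sigma> *\<^sub>R (\<zeta> r - c)) has_derivative (\<lambda>h. h \<bullet> G \<delta> \<kappa> (\<sigma> *\<^sub>R (\<zeta> r - c)) (\<sigma> *\<^sub>R (x - y))))
      (at (\<sigma> *\<^sub>R (x - y)))"
    using GDERIV_V \<delta> unfolding gderiv_def by blast
  then have "((\<lambda>x. \<sigma> * V \<delta> \<kappa> (\<sigma> *\<^sub>R (\<zeta> r - c)) (\<sigma> *\<^sub>R (x - y))) has_derivative
      (\<lambda>h. \<sigma> * ((\<sigma> *\<^sub>R h) \<bullet> G \<delta> \<kappa> (\<sigma> *\<^sub>R (\<zeta> r - c)) (\<sigma> *\<^sub>R (x - y))))) (at x)"
    by (rule has_derivative_mult_right[OF has_derivative_compose[rotated]])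
      (auto intro!: derivative_eq_intros)
  then show "GDERIV (test \<sigma> \<delta> \<kappa> c \<zeta> y r) x :> G \<delta> \<kappa> (\<sigma> *\<^sub>R (\<zeta> r - c)) (\<sigma> *\<^sub>R (x - y))"
    using \<sigma> unfolding gderiv_def test_def[abs_def] by (auto simp: inner_diff_left)
  then show "grad (test \<sigma> \<delta> \<kappa> c \<zeta> y r) x = G \<delta> \<kappa> (\<sigma> *\<^sub>R (\<zeta> r - c)) (\<sigma> *\<^sub>R (x - y))"
    by (rule grad_eqI)
qed

lemma lipschitz_grad_test:
  assumes "norm (\<zeta> r - c) \<le> \<kappa>"
  shows "(2 / \<delta>)-lipschitz_on UNIV (grad (test \<sigma> \<delta> \<kappa> c \<zeta> y r))"
proof (rule lipschitz_onI)
  fix x x'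
  have "norm (\<sigma> *\<^sub>R (\<zeta> r - c)) \<le> \<kappa>" using assms \<sigma> by auto
  from G_diff_le[OF this this \<delta>, of "\<sigma> *\<^sub>R (x - y)" "\<sigma> *\<^sub>R (x' - y)"]
  show "dist (grad (test \<sigma> \<delta> \<kappa> c \<zeta> y r) x) (grad (test \<sigma> \<delta> \<kappa> c \<zeta> y r) x') \<le> 2 / \<delta> * dist x x'"
    using \<sigma> by (auto simp: grad_test(2)[where \<zeta>=\<zeta> and r=r, OF assms] dist_norm norm_minus_commute)
qed (use \<delta> in auto)

lemma D2_norm_test_le:
  assumes "\<And>r. r \<in> I \<Longrightarrow> norm (\<zeta> r - c) \<le> \<kappa>"
  shows "D2_norm I (test \<sigma> \<delta> \<kappa> c \<zeta> y) \<le> ennreal (2 / \<delta>)"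
  unfolding D2_norm_def
  by (intro SUP_least INF_lower) (simp add: lipschitz_grad_test assms)

lemma test_in_UC:
  assumes "norm (\<zeta> r - c) \<le> \<kappa>"
  shows "test \<sigma> \<delta> \<kappa> c \<zeta> y r \<in> UC"
proof -
  have "L-lipschitz_on UNIV (test \<sigma> \<delta> \<kappa> c \<zeta> y r)"
  proof (rule lipschitz_onI)
    fix x x'
    have "norm (\<sigma> *\<^sub>R (\<zeta> r - c)) \<le> \<kappa>" using assms \<sigma> by auto
    from V_diff_le[OF this this, of \<delta> "\<sigma> *\<^sub>R (x - y)" "\<sigma> *\<^sub>R (x' - y)"]
    show "dist (test \<sigma> \<delta> \<kappa> c \<zeta> y r x) (test \<sigma> \<delta> \<kappa> c \<zeta> y r x') \<le> L * dist x x'"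
      using \<sigma> by (auto simp: test_def dist_norm norm_minus_commute abs_minus_commute)
  qed (use L_pos in simp)
  then show ?thesis by (rule lipschitz_in_UC)
qed

lemma C_C11_test:
  assumes \<zeta>: "continuous_on I \<zeta>" and bd: "\<And>r. r \<in> I \<Longrightarrow> norm (\<zeta> r - c) \<le> \<kappa>"
  shows "C_C11 I (test \<sigma> \<delta> \<kappa> c \<zeta> y)"
proof -
  let ?f = "\<lambda>(r, x). (\<sigma> *\<^sub>R (\<zeta> r - c), \<sigma> *\<^sub>R (x - y))"
  have "continuous_on (I \<times> UNIV) (\<lambda>v. \<zeta> (fst v))"
    using \<zeta> by (rule continuous_on_compose2) (auto intro!: continuous_intros)
  then have f: "continuous_on (I \<times> UNIV) ?f"
    unfolding case_prod_beta by (intro continuous_intros)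
  have im: "?f ` (I \<times> UNIV) \<subseteq> {\<eta>. norm \<eta> \<le> \<kappa>} \<times> UNIV"
    using bd \<sigma> by (auto simp: norm_minus_commute)
  have "continuous_on (I \<times> UNIV) (\<lambda>v. \<sigma> * (case ?f v of (\<eta>, z) \<Rightarrow> V \<delta> \<kappa> \<eta> z))"
    by (intro continuous_intros continuous_on_compose2[OF continuous_on_V f im] \<delta>)
  then have "continuous_on (I \<times> UNIV) (\<lambda>(t, x). test \<sigma> \<delta> \<kappa> c \<zeta> y t x)"
    by (simp add: case_prod_beta test_def)
  moreover have "continuous_on (I \<times> UNIV) (\<lambda>v. case ?f v of (\<eta>, z) \<Rightarrow> G \<delta> \<kappa> \<eta> z)"
    by (intro continuous_on_compose2[OF continuous_on_G f im] \<delta>)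
  then have "continuous_on (I \<times> UNIV) (\<lambda>(t, x). grad (test \<sigma> \<delta> \<kappa> c \<zeta> y t) x)"
    by (rule continuous_on_eq) (auto simp: grad_test(2) bd)
  moreover have "test \<sigma> \<delta> \<kappa> c \<zeta> y t differentiable (at x)" if "t \<in> I" for t x
    using grad_test(1)[where \<zeta> = \<zeta> and r = t, OF bd[OF that]] unfolding gderiv_def differentiable_def by blast
  ultimately show ?thesis
    unfolding C_C11_def using lipschitz_grad_test bd by blast
qed

text \<open>The path is approximated by polynomials, for which \<open>V_has_derivative_path\<close>
  gives the equation pointwise. The slack between \<kappa>' and \<kappa> keeps the approximations
  where the potential is convex; the Lipschitz constant 2/\<delta> of the gradients does not depend
  on the path.\<close>

lemma smooth_solution_test:
  assumes \<zeta>: "continuous_on {0..T} \<zeta>" and I: "I \<subseteq> {0..T}"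
    and bd: "\<And>r. r \<in> I \<Longrightarrow> norm (\<zeta> r - c) \<le> \<kappa>'" and "\<kappa>' < \<kappa>"
  shows "smooth_solution H I \<zeta> (test \<sigma> \<delta> \<kappa> c \<zeta> y)"
proof -
  obtain g where g: "uniform_limit {0..T} g \<zeta> sequentially" and poly: "\<And>n. polynomial_function (g n)"
    using Stone_Weierstrass_uniform_limit[OF compact_Icc \<zeta>] by blast
  have "\<exists>N. \<forall>n\<ge>N. \<forall>r\<in>{0..T}. dist (g n r) (\<zeta> r) < \<kappa> - \<kappa>'"
    using g \<open>\<kappa>' < \<kappa>\<close> unfolding uniform_limit_sequentially_iff by simp
  then obtain N where N: "\<And>n r. n \<ge> N \<Longrightarrow> r \<in> {0..T} \<Longrightarrow> dist (g n r) (\<zeta> r) < \<kappa> - \<kappa>'"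
    by blast
  \<comment> \<open>Dropping the first \<open>N\<close> terms makes the bound by \<kappa> hold for
    every index.\<close>
  define \<zeta>n where "\<zeta>n n = g (n + N)" for n
  let ?\<Phi> = "\<lambda>n. test \<sigma> \<delta> \<kappa> c (\<zeta>n n) y"
  have lim: "uniform_limit I \<zeta>n \<zeta> sequentially"
    unfolding uniform_limit_sequentially_iff
  proof (intro allI impI)
    fix e :: real assume "0 < e"
    then obtain M where M: "\<And>n r. n \<ge> M \<Longrightarrow> r \<in> {0..T} \<Longrightarrow> dist (g n r) (\<zeta> r) < e"
      using g unfolding uniform_limit_sequentially_iff by blast
    then show "\<exists>M. \<forall>n\<ge>M. \<forall>r\<in>I. dist (\<zeta>n n r) (\<zeta> r) < e"
      using I by (intro exI[of _ M]) (auto simp: \<zeta>n_def)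
  qed
  have bd\<zeta>: "norm (\<zeta> r - c) \<le> \<kappa>" if "r \<in> I" for r
    using bd[OF that] \<open>\<kappa>' < \<kappa>\<close> by simp
  have bdn: "norm (\<zeta>n n r - c) \<le> \<kappa>" if "r \<in> I" for n r
  proof -
    have "norm (\<zeta>n n r - c) \<le> norm (\<zeta>n n r - \<zeta> r) + norm (\<zeta> r - c)"
      using norm_triangle_ineq[of "\<zeta>n n r - \<zeta> r" "\<zeta> r - c"] by simp
    also have "norm (\<zeta>n n r - \<zeta> r) \<le> \<kappa> - \<kappa>'"
      using N[of "n + N" r] that I by (auto simp: \<zeta>n_def dist_norm)
    finally show ?thesis using bd[OF that] by simp
  qed
  have polyn: "polynomial_function (\<zeta>n n)" for n
    by (simp add: \<zeta>n_def poly)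
  have C1: "\<zeta>n n C1_differentiable_on I" for n
  proof -
    obtain p where "polynomial_function p" "\<And>x. (\<zeta>n n has_vector_derivative p x) (at x)"
      using has_vector_derivative_polynomial_function[OF polyn] by blast
    then show ?thesis
      unfolding C1_differentiable_on_def using continuous_on_polymonial_function by blast
  qed
  have cn: "continuous_on I (\<zeta>n n)" for n
    using polyn by (rule continuous_on_polymonial_function)
  have deriv: "((\<lambda>r. ?\<Phi> n r x) has_real_derivative
      (\<Sum>i\<in>UNIV. H (grad (?\<Phi> n t) x) $ i * vector_derivative (\<zeta>n n) (at t) $ i)) (at t within I)"
    if t: "t \<in> I" for n t x
  proof -
    let ?D = "vector_derivative (\<zeta>n n) (at t)" and ?z = "\<sigma> *\<^sub>R (x - y)"
    have "(\<zeta>n n has_vector_derivative ?D) (at t)"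
      using differentiable_at_polynomial_function[OF polyn]
      by (simp add: vector_derivative_works)
    then have "((\<lambda>r. \<zeta>n n r - c) has_vector_derivative ?D) (at t within I)"
      by (simp add: has_vector_derivative_at_within has_vector_derivative_diff_const)
    then have "((\<lambda>r. \<sigma> *\<^sub>R (\<zeta>n n r - c)) has_vector_derivative \<sigma> *\<^sub>R ?D) (at t within I)"
      by (rule bounded_linear.has_vector_derivative[OF bounded_linear_scaleR_right])
    then have "((\<lambda>r. V \<delta> \<kappa> (\<sigma> *\<^sub>R (\<zeta>n n r - c)) ?z) has_real_derivative
        (\<sigma> *\<^sub>R ?D) \<bullet> H (G \<delta> \<kappa> (\<sigma> *\<^sub>R (\<zeta>n n t - c)) ?z)) (at t within I)"
      by (rule V_has_derivative_path) (use t bdn \<sigma> \<delta> in auto)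
    then have "((\<lambda>r. \<sigma> * V \<delta> \<kappa> (\<sigma> *\<^sub>R (\<zeta>n n r - c)) ?z) has_real_derivative
        \<sigma> * ((\<sigma> *\<^sub>R ?D) \<bullet> H (G \<delta> \<kappa> (\<sigma> *\<^sub>R (\<zeta>n n t - c)) ?z))) (at t within I)"
      by (rule DERIV_cmult)
    \<comment> \<open>Again the square of \<sigma> is 1, so both signs lead to the same
      equation.\<close>
    also have "\<sigma> * ((\<sigma> *\<^sub>R ?D) \<bullet> H (G \<delta> \<kappa> (\<sigma> *\<^sub>R (\<zeta>n n t - c)) ?z)) =
        (\<Sum>i\<in>UNIV. H (grad (?\<Phi> n t) x) $ i * ?D $ i)"
      using \<sigma> by (auto simp: grad_test(2)[where \<zeta> = "\<zeta>n n" and r = t, OF bdn[OF t]] inner_vec_def mult.commute sum_negf)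
    finally show ?thesis by (simp add: test_def)
  qed
  have "uniform_limit (I \<times> UNIV) (\<lambda>n (t, x). ?\<Phi> n t x) (\<lambda>(t, x). test \<sigma> \<delta> \<kappa> c \<zeta> y t x) sequentially"
  proof (rule uniform_limitI)
    fix e :: real assume e: "0 < e"
    then have "\<forall>\<^sub>F n in sequentially. \<forall>r\<in>I. dist (\<zeta>n n r) (\<zeta> r) < e / (B + 1)"
      using lim B_nonneg by (intro uniform_limitD) auto
    then show "\<forall>\<^sub>F n in sequentially. \<forall>v\<in>I \<times> UNIV.
        dist (case v of (t, x) \<Rightarrow> ?\<Phi> n t x) (case v of (t, x) \<Rightarrow> test \<sigma> \<delta> \<kappa> c \<zeta> y t x) < e"
    proof eventually_elim
      case (elim n)
      have "\<bar>?\<Phi> n t x - test \<sigma> \<delta> \<kappa> c \<zeta> y t x\<bar> < e" if t: "t \<in> I" for t x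
      proof -
        have "\<bar>?\<Phi> n t x - test \<sigma> \<delta> \<kappa> c \<zeta> y t x\<bar> \<le> B * dist (\<zeta>n n t) (\<zeta> t)"
          using V_diff_le[of "\<sigma> *\<^sub>R (\<zeta>n n t - c)" \<kappa> "\<sigma> *\<^sub>R (\<zeta> t - c)" \<delta> "\<sigma> *\<^sub>R (x - y)" "\<sigma> *\<^sub>R (x - y)"]
            bdn[OF t] bd\<zeta>[OF t] \<sigma>
          by (auto simp: test_def dist_norm norm_minus_commute abs_minus_commute)
        also have "\<dots> \<le> (B + 1) * dist (\<zeta>n n t) (\<zeta> t)"
          by (intro mult_right_mono) auto
        also have "\<dots> < e"
          using elim t B_nonneg by (simp add: pos_less_divide_eq mult.commute)
        finally show ?thesis .
      qed
      then show ?case by (auto simp: dist_real_def)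
    qed
  qed
  moreover have "uniform_limit (I \<times> UNIV) (\<lambda>n (t, x). grad (?\<Phi> n t) x)
      (\<lambda>(t, x). grad (test \<sigma> \<delta> \<kappa> c \<zeta> y t) x) sequentially"
  proof (rule uniform_limitI)
    fix e :: real assume e: "0 < e"
    \<comment> \<open>This threshold inverts the square root in \<open>G_diff_le\<close>;
      \<open>B + 1\<close> avoids dividing by zero.\<close>
    then have "\<forall>\<^sub>F n in sequentially. \<forall>r\<in>I. dist (\<zeta>n n r) (\<zeta> r) < e\<^sup>2 * \<delta> / (4 * (B + 1))"
      using lim B_nonneg \<delta> by (intro uniform_limitD) auto
    then show "\<forall>\<^sub>F n in sequentially. \<forall>v\<in>I \<times> UNIV.
        dist (case v of (t, x) \<Rightarrow> grad (?\<Phi> n t) x) (case v of (t, x) \<Rightarrow> grad (test \<sigma> \<delta> \<kappa> c \<zeta> y t) x) < e"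
    proof eventually_elim
      case (elim n)
      have "dist (grad (?\<Phi> n t) x) (grad (test \<sigma> \<delta> \<kappa> c \<zeta> y t) x) < e" if t: "t \<in> I" for t x
      proof -
        have "dist (grad (?\<Phi> n t) x) (grad (test \<sigma> \<delta> \<kappa> c \<zeta> y t) x) \<le> sqrt (4 * B / \<delta> * dist (\<zeta>n n t) (\<zeta> t))"
          using G_diff_le[of "\<sigma> *\<^sub>R (\<zeta>n n t - c)" \<kappa> "\<sigma> *\<^sub>R (\<zeta> t - c)" \<delta> "\<sigma> *\<^sub>R (x - y)" "\<sigma> *\<^sub>R (x - y)"]
            bdn[OF t] bd\<zeta>[OF t] \<sigma> \<delta>
          unfolding grad_test(2)[where \<zeta> = "\<zeta>n n" and r = t, OF bdn[OF t]] grad_test(2)[where \<zeta> = \<zeta> and r = t, OF bd\<zeta>[OF t]]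
          by (auto simp: dist_norm norm_minus_commute)
        also have "4 * B / \<delta> * dist (\<zeta>n n t) (\<zeta> t) \<le> 4 * (B + 1) / \<delta> * dist (\<zeta>n n t) (\<zeta> t)"
          using \<delta> by (intro mult_right_mono divide_right_mono) auto
        also have "\<dots> < e\<^sup>2"
          using elim t B_nonneg \<delta> by (simp add: field_simps)
        finally show ?thesis using e by (simp add: real_less_lsqrt)
      qed
      then show ?case by auto
    qed
  qed
  ultimately have lims: "\<forall>Q. compact Q \<and> Q \<subseteq> I \<times> UNIV \<longrightarrow>
      uniform_limit Q (\<lambda>n (t, x). ?\<Phi> n t x) (\<lambda>(t, x). test \<sigma> \<delta> \<kappa> c \<zeta> y t x) sequentially \<and>
      uniform_limit Q (\<lambda>n (t, x). grad (?\<Phi> n t) x) (\<lambda>(t, x). grad (test \<sigma> \<delta> \<kappa> c \<zeta> y t) x) sequentially"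
    by (blast intro: uniform_limit_on_subset)
  have lip: "\<forall>J. compact J \<and> J \<subseteq> I \<longrightarrow> (\<exists>K. \<forall>n. \<forall>t\<in>J. K-lipschitz_on UNIV (grad (?\<Phi> n t)))"
    using lipschitz_grad_test bdn by blast
  have "C_C11 I (test \<sigma> \<delta> \<kappa> c \<zeta> y)"
    using continuous_on_subset[OF \<zeta> I] bd\<zeta> by (rule C_C11_test)
  moreover have "C_C11 I (?\<Phi> n)" for n
    using cn bdn by (rule C_C11_test)
  ultimately show ?thesis
    unfolding smooth_solution_def
    by (intro conjI exI[of _ \<zeta>n] exI[of _ ?\<Phi>] lims lip lim allI ballI C1 deriv)
qed

end

section \<open>Comparison of pathwise solutions with smooth solutions\<close>

text \<open>An ordering with a test function at time \<open>s\<close> persists. A violation at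
  \<open>t\<close> is turned into an interior maximum of the difference minus an increasing function
  of time, which contradicts the sub- or supersolution property.\<close>

lemma pathwise_comparison:
  assumes \<sigma>: "\<sigma> = 1 \<or> \<sigma> = - 1" and \<delta>: "0 < \<delta>"
    and u: "pathwise_BUC_solution H T W u0 u" and W: "continuous_on {0..T} W"
    and st: "0 \<le> s" "s \<le> t" "t \<le> T"
    and bd: "\<And>r. r \<in> {s..t} \<Longrightarrow> norm (W r - c) \<le> \<kappa>'" and "\<kappa>' < \<kappa>"
    and init: "\<And>y. \<sigma> * u s y \<le> a + \<sigma> * test \<sigma> \<delta> \<kappa> c W x s y"
  shows "\<sigma> * u t y \<le> a + \<sigma> * test \<sigma> \<delta> \<kappa> c W x t y"
proof (rule ccontr)
  define f where "f r z = \<sigma> * u r z - \<sigma> * test \<sigma> \<delta> \<kappa> c W x r z" for r z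
  define g where "g = f t y - a"
  assume "\<not> ?thesis"
  then have "0 < g" by (simp add: g_def f_def)
  then have "s \<noteq> t" using init[of y] by (auto simp: g_def f_def)
  then have "s < t" using st by simp
  have bd\<kappa>: "norm (W r - c) \<le> \<kappa>" if "r \<in> {s..t}" for r
    using bd[OF that] \<open>\<kappa>' < \<kappa>\<close> by simp
  have sub: "{s..t} \<subseteq> {0..T}" using st by auto
  have "continuous_on ({0..T} \<times> UNIV) (\<lambda>(r, z). u r z)"
    using u unfolding pathwise_BUC_solution_def by (blast intro: uniformly_continuous_imp_continuous)
  then have "continuous_on ({s..t} \<times> UNIV) (\<lambda>(r, z). u r z)"
    by (rule continuous_on_subset) (use sub in auto)
  moreover have "C_C11 {s..t} (test \<sigma> \<delta> \<kappa> c W x)"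
    using \<sigma> \<delta> continuous_on_subset[OF W sub] bd\<kappa> by (rule C_C11_test)
  then have "continuous_on ({s..t} \<times> UNIV) (\<lambda>(r, z). test \<sigma> \<delta> \<kappa> c W x r z)"
    by (simp add: C_C11_def)
  ultimately have cont_f: "continuous_on ({s..t} \<times> UNIV) (\<lambda>(r, z). f r z)"
    unfolding f_def case_prod_beta by (intro continuous_intros)

  obtain U where U: "\<And>r z. r \<in> {s..t} \<Longrightarrow> \<bar>u r z\<bar> \<le> U"
  proof -
    have "bounded ((\<lambda>(r, z). u r z) ` ({0..T} \<times> UNIV))"
      using u by (simp add: pathwise_BUC_solution_def)
    then obtain U where "\<forall>v\<in>(\<lambda>(r, z). u r z) ` ({0..T} \<times> UNIV). norm v \<le> U"
      unfolding bounded_iff by blast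
    then have "\<bar>u r z\<bar> \<le> U" if "r \<in> {s..t}" for r z
      using that sub by fastforce
    then show thesis using that by blast
  qed
  \<comment> \<open>With the bound \<open>U\<close> on \<open>u\<close>, the growth from
    \<open>V_ge\<close> makes \<open>f\<close> decay linearly in space, uniformly in time.\<close>
  define K where "K = U + \<delta> / 2 * L\<^sup>2 + 2 * \<kappa> * B"
  have f_le: "f r z \<le> K - L * norm (z - x)" if "r \<in> {s..t}" for r z
  proof -
    have "norm (\<sigma> *\<^sub>R (W r - c)) \<le> \<kappa>"
      using bd\<kappa>[OF that] \<sigma> by (auto simp: norm_minus_commute)
    from V_ge[OF this, of \<delta> "\<sigma> *\<^sub>R (z - x)"]
    have "\<sigma> * test \<sigma> \<delta> \<kappa> c W x r z \<ge> L * norm (z - x) - \<delta> / 2 * L\<^sup>2 - 2 * \<kappa> * B"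
      using \<sigma> \<delta> by (auto simp: test_def norm_minus_commute)
    moreover have "\<sigma> * u r z \<le> U"
      using U[OF that, of z] \<sigma> by auto
    ultimately show ?thesis by (simp add: f_def K_def)
  qed

  \<comment> \<open>By continuity half of the excess is already present before \<open>t\<close>;
    this leaves room for \<psi> to grow between \<open>t'\<close> and \<open>t\<close>.\<close>
  obtain t' where t': "s < t'" "t' < t" "f t' y > a + g / 2"
  proof -
    have "continuous_on {s..t} (\<lambda>r. (\<lambda>(r, z). f r z) (r, y))"
      by (rule continuous_on_compose2[OF cont_f]) (auto intro!: continuous_intros)
    then have "((\<lambda>r. f r y) \<longlongrightarrow> f t y) (at t within {s..t})"
      using \<open>s < t\<close> by (simp add: continuous_on_def)
    then have "((\<lambda>r. f r y) \<longlongrightarrow> f t y) (at_left t)"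
      using \<open>s < t\<close> by (simp add: at_within_Icc_at_left)
    then have "\<forall>\<^sub>F r in at_left t. a + g / 2 < f r y"
      by (rule order_tendstoD) (use \<open>0 < g\<close> in \<open>simp add: g_def field_simps\<close>)
    then have "\<forall>\<^sub>F r in at_left t. s < r \<and> r < t \<and> a + g / 2 < f r y"
      using eventually_at_left_real[OF \<open>s < t\<close>] by eventually_elim auto
    then show thesis
      using that eventually_happens trivial_limit_at_left_real by blast
  qed
  \<comment> \<open>\<open>\<psi>\<close> is strictly increasing, small up to \<open>t'\<close> and large at \<open>t\<close>. Hence \<open>f - \<psi>\<close> has its maximum at a time in
    \<open>(s, t)\<close>, where the definition of a solution forces \<open>\<psi>' \<le> 0\<close>.\<close>
  define d where "d = (t - t') / 2"
  define k where "k = (8 / g + \<bar>K - a\<bar>) / d"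
  define \<eta> where "\<eta> = g / 8 / (t - s)"
  define \<psi> where "\<psi> r = \<eta> * (r - s) + exp (k * (r - (t' + d)))" for r
  have "0 < d" using t' by (simp add: d_def)
  have kd: "k * d = 8 / g + \<bar>K - a\<bar>" using \<open>0 < d\<close> by (simp add: k_def)
  have "0 < k" using \<open>0 < d\<close> \<open>0 < g\<close> by (auto simp: k_def intro!: divide_pos_pos add_pos_nonneg)
  have "0 < \<eta>" using \<open>0 < g\<close> \<open>s < t\<close> by (simp add: \<eta>_def)
  \<comment> \<open>This inequality serves both times: at \<open>t\<close> the exponent is
    \<open>k * d\<close> and \<psi> exceeds \<open>K - a\<close>, at \<open>t'\<close> it is
    \<open>- (k * d)\<close> and the exponential is below \<open>g / 8\<close>. The linear part adds
    at most \<open>g / 8\<close> at \<open>t'\<close>.\<close>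
  have exp_kd: "exp (k * d) > 8 / g + \<bar>K - a\<bar>"
    using exp_ge_add_one_self[of "k * d"] kd by linarith
  have \<psi>_nonneg: "0 \<le> \<psi> r" if "r \<in> {s..t}" for r
    using that \<open>0 < \<eta>\<close> by (simp add: \<psi>_def)
  have \<psi>_t: "\<psi> t > K - a"
  proof -
    have *: "t - (t' + d) = d" by (simp add: d_def field_simps)
    have "\<psi> t \<ge> exp (k * d)" unfolding \<psi>_def * using \<open>0 < \<eta>\<close> \<open>s < t\<close> by simp
    moreover have "0 < 8 / g" using \<open>0 < g\<close> by simp
    ultimately show ?thesis using exp_kd by linarith
  qed
  have \<psi>_t': "\<psi> t' < g / 4"
  proof -
    have "\<eta> * (t' - s) \<le> \<eta> * (t - s)"
      using t' \<open>0 < \<eta>\<close> by (intro mult_left_mono) auto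
    also have "\<dots> = g / 8"
    proof -
      have *: "p / q * q = p" if "q \<noteq> 0" for p q :: real
        using that by simp
      show ?thesis
        unfolding \<eta>_def by (rule *) (use \<open>s < t\<close> in simp)
    qed
    finally have "\<eta> * (t' - s) \<le> g / 8" .
    moreover have "exp (k * (t' - (t' + d))) < g / 8"
    proof -
      have "8 / g < exp (k * d)" using exp_kd by linarith
      then have "inverse (exp (k * d)) < inverse (8 / g)"
        using \<open>0 < g\<close> by (intro less_imp_inverse_less) auto
      then show ?thesis by (simp add: exp_minus)
    qed
    ultimately show ?thesis by (simp add: \<psi>_def)
  qed
  have D\<psi>: "(\<psi> has_real_derivative \<eta> + k * exp (k * (r - (t' + d)))) (at r)" for r
    unfolding \<psi>_def[abs_def] by (auto intro!: derivative_eq_intros)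
  have C1: "\<psi> C1_differentiable_on {0..T}" "(\<lambda>r. - \<psi> r) C1_differentiable_on {0..T}"
  proof -
    show "\<psi> C1_differentiable_on {0..T}"
      unfolding C1_differentiable_on_def using D\<psi>
      by (intro exI[of _ "\<lambda>r. \<eta> + k * exp (k * (r - (t' + d)))"])
        (auto intro!: continuous_intros simp: has_real_derivative_iff_has_vector_derivative)
    then show "(\<lambda>r. - \<psi> r) C1_differentiable_on {0..T}"
      by (rule C1_differentiable_on_minus)
  qed

  \<comment> \<open>Outside this ball the decay of \<open>f\<close> forces \<open>F < a\<close>; the
    first summand puts \<open>y\<close> inside, so the maximum over the compact set is global in
    space.\<close>
  define R where "R = norm (y - x) + \<bar>K - a\<bar> / L"
  define F where "F r z = f r z - \<psi> r" for r z
  have "continuous_on ({s..t} \<times> cball x R) (\<lambda>(r, z). f r z)"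
    using cont_f by (rule continuous_on_subset) auto
  then have "continuous_on ({s..t} \<times> cball x R) (\<lambda>(r, z). F r z)"
    unfolding F_def \<psi>_def case_prod_beta by (intro continuous_intros)
  moreover have yR: "y \<in> cball x R"
    using L_pos by (simp add: R_def dist_norm norm_minus_commute)
  moreover have "compact ({s..t} \<times> cball x R)"
    by (intro compact_Times compact_Icc compact_cball)
  moreover have "{s..t} \<times> cball x R \<noteq> {}"
  proof -
    have "(s, y) \<in> {s..t} \<times> cball x R"
      using yR \<open>s < t\<close> by (simp del: mem_cball)
    then show ?thesis by blast
  qed
  ultimately obtain v where v: "v \<in> {s..t} \<times> cball x R"
      "\<forall>w\<in>{s..t} \<times> cball x R. (case w of (r, z) \<Rightarrow> F r z) \<le> (case v of (r, z) \<Rightarrow> F r z)"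
    using continuous_attains_sup by blast
  obtain t0 y0 where "v = (t0, y0)" by (cases v)
  with v(1) have m: "t0 \<in> {s..t}" "y0 \<in> cball x R" by auto
  have max_R: "F r z \<le> F t0 y0" if "r \<in> {s..t}" "z \<in> cball x R" for r z
    using bspec[OF v(2), of "(r, z)"] that \<open>v = (t0, y0)\<close> by simp
  have "F t' y > a"
    using t'(3) \<psi>_t' \<open>0 < g\<close> by (simp add: F_def)
  then have Fa: "F t0 y0 > a"
    using max_R[of t' y] t' yR by simp
  have max: "F r z \<le> F t0 y0" if r: "r \<in> {s..t}" for r z
  proof (cases "z \<in> cball x R")
    case False
    then have "norm (z - x) > \<bar>K - a\<bar> / L"
      using norm_ge_zero[of "y - x"] unfolding R_def mem_cball dist_norm norm_minus_commute[of x]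
      by linarith
    then have "L * norm (z - x) > \<bar>K - a\<bar>"
      using L_pos by (simp add: pos_divide_less_eq mult.commute)
    then have "F r z < a"
      using f_le[OF r, of z] \<psi>_nonneg[OF r] by (simp add: F_def)
    then show ?thesis using Fa by simp
  qed (use max_R r in blast)
  \<comment> \<open>At \<open>s\<close> the initial ordering gives \<open>F \<le> a\<close>; at
    \<open>t\<close> the size of \<psi> does. Only an interior time is left.\<close>
  have "t0 \<noteq> s"
    using Fa init[of y0] \<psi>_nonneg[OF m(1)] by (auto simp: F_def f_def)
  moreover have "t0 \<noteq> t"
  proof
    assume "t0 = t"
    moreover have "0 \<le> L * norm (y0 - x)" using L_pos by simp
    ultimately show False using Fa f_le[OF m(1), of y0] \<psi>_t by (simp add: F_def)
  qed
  ultimately have t0: "t0 \<in> {s<..<t}" using m(1) by auto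
  have I: "open {s<..<t}" "is_interval {s<..<t}" "{s<..<t} \<subseteq> {0..T}"
    using sub by (auto simp: is_interval_oo)
  have smooth: "smooth_solution H {s<..<t} W (test \<sigma> \<delta> \<kappa> c W x)"
    using \<sigma> \<delta> W I(3) bd \<open>\<kappa>' < \<kappa>\<close> by (intro smooth_solution_test[where T = T and \<kappa>' = \<kappa>']) auto
  have ev: "\<forall>\<^sub>F v in at (t0, y0) within {s<..<t} \<times> UNIV. F (fst v) (snd v) \<le> F t0 y0"
    unfolding eventually_at_filter by (rule always_eventually) (use max in auto)
  have pos: "0 < \<eta> + k * exp (k * (t0 - (t' + d)))"
    using \<open>0 < \<eta>\<close> \<open>0 < k\<close> by (simp add: add_pos_pos)
  from \<sigma> show False
  proof
    assume [simp]: "\<sigma> = 1"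
    have "local_max_at ({s<..<t} \<times> UNIV) (\<lambda>(r, z). u r z - test \<sigma> \<delta> \<kappa> c W x r z - \<psi> r) (t0, y0)"
      using ev t0 by (simp add: local_max_at_def F_def f_def case_prod_beta)
    then have "deriv \<psi> t0 \<le> 0"
      using u I C1 smooth unfolding pathwise_BUC_solution_def pathwise_subsolution_def by blast
    then show False using DERIV_imp_deriv[OF D\<psi>, of t0] pos by simp
  next
    assume [simp]: "\<sigma> = - 1"
    have "local_min_at ({s<..<t} \<times> UNIV) (\<lambda>(r, z). u r z - test \<sigma> \<delta> \<kappa> c W x r z - (- \<psi> r)) (t0, y0)"
      using ev t0 by (simp add: local_min_at_def F_def f_def case_prod_beta algebra_simps)
    then have "deriv (\<lambda>r. - \<psi> r) t0 \<ge> 0"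
      using u I C1 smooth unfolding pathwise_BUC_solution_def pathwise_supersolution_def by blast
    then show False using DERIV_imp_deriv[OF DERIV_minus[OF D\<psi>], of t0] pos by simp
  qed
qed

end

section \<open>The interpolated path\<close>

text \<open>Time is counted in coarse steps, so the nodes are the integers and estimates do not
  involve the step length.\<close>

definition affine_interpolation :: "(int \<Rightarrow> 'a::real_vector) \<Rightarrow> real \<Rightarrow> 'a" where
  "affine_interpolation X \<theta> = X \<lfloor>\<theta>\<rfloor> + (\<theta> - \<lfloor>\<theta>\<rfloor>) *\<^sub>R (X (\<lfloor>\<theta>\<rfloor> + 1) - X \<lfloor>\<theta>\<rfloor>)"

text \<open>Within a cell the path is affine. Otherwise the increment splits into a partial cell,
  whole cells by telescoping, and a partial cell; their lengths add up to \<theta>' -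
  \<theta>.\<close>

lemma norm_affine_interpolation_diff_le:
  fixes X :: "int \<Rightarrow> 'a::real_normed_vector"
  assumes X: "\<And>k. 0 \<le> k \<Longrightarrow> norm (X (k + 1) - X k) \<le> D" and \<theta>: "0 \<le> \<theta>" "\<theta> \<le> \<theta>'"
  shows "norm (affine_interpolation X \<theta>' - affine_interpolation X \<theta>) \<le> D * (\<theta>' - \<theta>)"
proof -
  define j k where "j = \<lfloor>\<theta>\<rfloor>" and "k = \<lfloor>\<theta>'\<rfloor>"
  have jk: "0 \<le> j" "j \<le> k" using \<theta> by (auto simp: j_def k_def floor_mono)
  show ?thesis
  proof (cases "j = k")
    case True
    then have "affine_interpolation X \<theta>' - affine_interpolation X \<theta> = (\<theta>' - \<theta>) *\<^sub>R (X (j + 1) - X j)"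
      by (simp add: affine_interpolation_def j_def[symmetric] k_def[symmetric] scaleR_left_diff_distrib)
    then show ?thesis
      using X[OF jk(1)] \<theta> by (simp add: mult.commute[of D] mult_left_mono)
  next
    case False
    have sum: "norm (X (i + int n) - X i) \<le> D * real n" if "0 \<le> i" for i n
    proof (induction n)
      case (Suc n)
      have "norm (X (i + int n + 1) - X i) \<le> norm (X (i + int n + 1) - X (i + int n)) + norm (X (i + int n) - X i)"
        by (rule norm_diff_triangle_ineq[of "X (i + int n + 1)" "X (i + int n)" "X (i + int n)" "X i", simplified])
      also have "\<dots> \<le> D + D * real n"
        using X[of "i + int n"] that Suc by auto
      finally show ?case by (simp add: algebra_simps)
    qed simp
    have "norm (affine_interpolation X \<theta>' - X k) \<le> D * (\<theta>' - k)"
    proof -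
      have "affine_interpolation X \<theta>' - X k = (\<theta>' - k) *\<^sub>R (X (k + 1) - X k)"
        by (simp add: affine_interpolation_def k_def)
      moreover have "0 \<le> \<theta>' - k" by (simp add: k_def)
      ultimately show ?thesis
        using X[of k] jk by (simp add: mult.commute[of D] mult_left_mono)
    qed
    moreover have "norm (X k - X (j + 1)) \<le> D * (real_of_int k - real_of_int j - 1)"
      using sum[of "j + 1" "nat (k - j - 1)"] jk False by simp
    moreover have "norm (X (j + 1) - affine_interpolation X \<theta>) \<le> D * (j + 1 - \<theta>)"
    proof -
      have "X (j + 1) - affine_interpolation X \<theta> = (j + 1 - \<theta>) *\<^sub>R (X (j + 1) - X j)"
        by (simp add: affine_interpolation_def j_def[symmetric] algebra_simps)
      moreover have "0 \<le> j + 1 - \<theta>" unfolding j_def by linarith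
      ultimately show ?thesis
        using X[OF jk(1)] by (simp add: mult.commute[of D] mult_left_mono)
    qed
    moreover have "norm (affine_interpolation X \<theta>' - affine_interpolation X \<theta>) \<le>
        norm (affine_interpolation X \<theta>' - X k) + norm (X k - X (j + 1)) + norm (X (j + 1) - affine_interpolation X \<theta>)"
      using norm_triangle_ineq[of "affine_interpolation X \<theta>' - X k" "X k - X (j + 1)"]
        norm_triangle_ineq[of "affine_interpolation X \<theta>' - X (j + 1)" "X (j + 1) - affine_interpolation X \<theta>"]
      by simp
    ultimately show ?thesis by (simp add: algebra_simps)
  qed
qed

lemma interpolated_path_eq:
  assumes "0 < \<tau>" and "\<tau> = real (coarse_steps \<rho>) * \<rho>"
  shows "interpolated_path T W \<rho> t = affine_interpolation (\<lambda>k. W (min (k * \<tau>) T)) (t / \<tau>)"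
proof -
  have "(t - k * \<tau>) / \<tau> = t / \<tau> - k" for k using assms(1) by (simp add: field_simps)
  then show ?thesis
    unfolding interpolated_path_def affine_interpolation_def Let_def assms(2)[symmetric]
    by (simp only: of_int_add of_int_1)
qed

section \<open>Slope, distance to \<open>W\<close> and oscillation of the interpolated path\<close>

locale path_interpolation =
  fixes T \<rho> :: real and \<omega> :: "real \<Rightarrow> real" and W :: "real \<Rightarrow> real ^ 'm"
  assumes T_pos: "0 < T" and \<rho>_pos: "0 < \<rho>" and steps_pos: "0 < coarse_steps \<rho>"
    and modulus: "modulus_of_continuity T \<omega> W"
begin

definition \<tau> :: real where "\<tau> = real (coarse_steps \<rho>) * \<rho>"

lemma \<rho>_le_\<tau>: "\<rho> \<le> \<tau>"
  using steps_pos \<rho>_pos by (simp add: \<tau>_def)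

lemma \<tau>_pos: "0 < \<tau>"
  using \<rho>_le_\<tau> \<rho>_pos by simp

lemma \<tau>_le_sqrt: "\<tau> \<le> sqrt \<rho>"
proof -
  have "real (coarse_steps \<rho>) \<le> \<rho> powr (- 1 / 2)"
    unfolding coarse_steps_def by (intro of_nat_floor) simp
  also have "\<dots> = 1 / sqrt \<rho>"
    using \<rho>_pos by (simp add: powr_minus_divide powr_half_sqrt)
  finally have "\<tau> \<le> 1 / sqrt \<rho> * \<rho>"
    unfolding \<tau>_def using \<rho>_pos by (intro mult_right_mono) auto
  then show ?thesis using \<rho>_pos by (simp add: real_div_sqrt)
qed

text \<open>At least one fine step per coarse step means \<rho> \<le> \<tau> \<le>
  \<open>sqrt \<rho>\<close>. The bound later absorbs the last step into
  \<open>T + 1\<close>.\<close>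

lemma \<rho>_le_1: "\<rho> \<le> 1"
proof (rule ccontr)
  assume "\<not> ?thesis"
  then have "sqrt \<rho> * 1 < sqrt \<rho> * sqrt \<rho>"
    by (intro mult_strict_left_mono) auto
  then show False using \<rho>_le_\<tau> \<tau>_le_sqrt \<rho>_pos by simp
qed

lemma path_diff_le:
  assumes "s \<in> {0..T}" and "t \<in> {0..T}" and "\<bar>s - t\<bar> \<le> sqrt \<rho>"
  shows "norm (W s - W t) \<le> \<omega> (sqrt \<rho>)"
proof -
  have "norm (W s - W t) \<le> \<omega> \<bar>s - t\<bar>"
    using modulus assms unfolding modulus_of_continuity_def by blast
  also have "\<dots> \<le> \<omega> (sqrt \<rho>)"
  proof (rule mono_onD[where f = \<omega> and A = "{0..}"])
    show "mono_on {0..} \<omega>" using modulus unfolding modulus_of_continuity_def by blast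
  qed (use assms \<rho>_pos in auto)
  finally show ?thesis .
qed

text \<open>The minimum with \<open>T\<close> realises the constant extension of \<open>W\<close>;
  it can only shorten a coarse step, whose length is at most \<open>sqrt \<rho>\<close>.\<close>

lemma \<tau>_grid_diff_le:
  assumes "0 \<le> k"
  shows "norm (W (min (real_of_int (k + 1) * \<tau>) T) - W (min (real_of_int k * \<tau>) T)) \<le> \<omega> (sqrt \<rho>)"
proof (rule path_diff_le)
  define a where "a = real_of_int k * \<tau>"
  have a: "0 \<le> a" "real_of_int (k + 1) * \<tau> = a + \<tau>"
    using assms \<tau>_pos by (auto simp: a_def distrib_right)
  show "min (real_of_int (k + 1) * \<tau>) T \<in> {0..T}" "min (real_of_int k * \<tau>) T \<in> {0..T}"
    using a T_pos \<tau>_pos unfolding a(2) a_def[symmetric] by auto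
  have "\<bar>min (a + \<tau>) T - min a T\<bar> \<le> \<tau>"
    using \<tau>_pos by linarith
  then show "\<bar>min (real_of_int (k + 1) * \<tau>) T - min (real_of_int k * \<tau>) T\<bar> \<le> sqrt \<rho>"
    using \<tau>_le_sqrt unfolding a(2) a_def[symmetric] by linarith
qed

lemma interpolated_path_lipschitz:
  assumes "0 \<le> s" and "0 \<le> t"
  shows "norm (interpolated_path T W \<rho> t - interpolated_path T W \<rho> s) \<le> \<omega> (sqrt \<rho>) * \<bar>t - s\<bar> / \<tau>"
proof -
  have *: "norm (interpolated_path T W \<rho> t - interpolated_path T W \<rho> s) \<le> \<omega> (sqrt \<rho>) * (t / \<tau> - s / \<tau>)"
    if "0 \<le> s" "s \<le> t" for s t
    unfolding interpolated_path_eq[OF \<tau>_pos \<tau>_def]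
  proof (rule norm_affine_interpolation_diff_le)
    show "norm (W (min (real_of_int (k + 1) * \<tau>) T) - W (min (real_of_int k * \<tau>) T)) \<le> \<omega> (sqrt \<rho>)"
      if "0 \<le> k" for k
      using that by (rule \<tau>_grid_diff_le)
  qed (use that \<tau>_pos in \<open>auto simp: divide_right_mono\<close>)
  show ?thesis
  proof (cases "s \<le> t")
    case True
    then show ?thesis using *[OF assms(1) True] by (simp add: diff_divide_distrib right_diff_distrib)
  next
    case False
    then show ?thesis using *[of t s] assms
      by (simp add: diff_divide_distrib right_diff_distrib norm_minus_commute[of "interpolated_path T W \<rho> s"])
  qed
qed

lemma continuous_on_interpolated_path: "continuous_on {0..} (interpolated_path T W \<rho>)"
proof -
  have "0 \<le> \<omega> (sqrt \<rho>)"
    using path_diff_le[of 0 0] T_pos \<rho>_pos by simp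
  then have "(\<omega> (sqrt \<rho>) / \<tau>)-lipschitz_on {0..} (interpolated_path T W \<rho>)"
    using \<tau>_pos interpolated_path_lipschitz by (intro lipschitz_onI) (auto simp: dist_norm)
  then show ?thesis by (rule lipschitz_on_continuous_on)
qed

text \<open>The value is a convex combination of two node values, both in the ball around
  \<open>W t\<close> because the nodes are within \<open>sqrt \<rho>\<close> of
  \<open>t\<close>.\<close>

lemma interpolated_path_close:
  assumes t: "t \<in> {0..T}"
  shows "norm (interpolated_path T W \<rho> t - W t) \<le> \<omega> (sqrt \<rho>)"
proof -
  define k where "k = \<lfloor>t / \<tau>\<rfloor>"
  define \<theta> where "\<theta> = t / \<tau> - k"
  define X where "X = (\<lambda>k. W (min (real_of_int k * \<tau>) T))"
  have \<theta>: "0 \<le> \<theta>" "\<theta> \<le> 1" by (auto simp: \<theta>_def k_def) linarith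
  have "0 \<le> k" using t \<tau>_pos by (simp add: k_def)
  have kt: "k * \<tau> \<le> t" "t \<le> k * \<tau> + \<tau>"
    using \<theta> \<tau>_pos by (auto simp: \<theta>_def field_simps)
  have "norm (X k - W t) \<le> \<omega> (sqrt \<rho>)"
    unfolding X_def using t kt \<open>0 \<le> k\<close> \<tau>_pos \<tau>_le_sqrt T_pos \<rho>_pos by (intro path_diff_le) auto
  moreover have "norm (X (k + 1) - W t) \<le> \<omega> (sqrt \<rho>)"
    unfolding X_def using t kt \<open>0 \<le> k\<close> \<tau>_pos \<tau>_le_sqrt T_pos
    by (intro path_diff_le) (auto simp: algebra_simps min_def)
  ultimately have le: "X k \<in> cball (W t) (\<omega> (sqrt \<rho>))" "X (k + 1) \<in> cball (W t) (\<omega> (sqrt \<rho>))"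
    by (auto simp: dist_norm norm_minus_commute)
  have "interpolated_path T W \<rho> t = (1 - \<theta>) *\<^sub>R X k + \<theta> *\<^sub>R X (k + 1)"
    unfolding interpolated_path_eq[OF \<tau>_pos \<tau>_def] affine_interpolation_def X_def[symmetric]
      k_def[symmetric] \<theta>_def[symmetric]
    by (simp add: algebra_simps)
  also have "\<dots> \<in> cball (W t) (\<omega> (sqrt \<rho>))"
    by (rule convexD[OF convex_cball le]) (use \<theta> in auto)
  finally show ?thesis by (simp add: dist_norm norm_minus_commute)
qed

text \<open>Slope times fine step: the gain over a coarse step is the factor \<rho>/\<tau>, which
  the monotonicity condition of the scheme exploits.\<close>

lemma osc_interpolated_path_le:
  assumes "0 \<le> s" and "s \<le> t" and "t \<le> s + \<rho>"
  shows "osc (interpolated_path T W \<rho>) s t \<le> \<omega> (sqrt \<rho>) * \<rho> / \<tau>"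
  unfolding osc_def
proof (rule cSUP_least)
  have "0 \<le> \<omega> (sqrt \<rho>)"
    using path_diff_le[of 0 0] T_pos \<rho>_pos by simp
  fix v assume "v \<in> {s..t} \<times> {s..t}"
  then have v: "0 \<le> fst v" "0 \<le> snd v" "\<bar>fst v - snd v\<bar> \<le> \<rho>" using assms by auto
  have "norm (interpolated_path T W \<rho> (fst v) - interpolated_path T W \<rho> (snd v))
      \<le> \<omega> (sqrt \<rho>) * \<bar>fst v - snd v\<bar> / \<tau>"
    using v by (intro interpolated_path_lipschitz)
  also have "\<dots> \<le> \<omega> (sqrt \<rho>) * \<rho> / \<tau>"
    using v \<open>0 \<le> \<omega> (sqrt \<rho>)\<close> \<tau>_pos by (intro divide_right_mono mult_left_mono) auto
  finally show "(case v of (r1, r2) \<Rightarrow> norm (interpolated_path T W \<rho> r1 - interpolated_path T W \<rho> r2))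
      \<le> \<omega> (sqrt \<rho>) * \<rho> / \<tau>"
    by (simp add: case_prod_beta)
qed (use assms in auto)

end
section \<open>The scheme\<close>

lemma grid_size_eq:
  assumes "0 < T" and "0 < \<rho>"
  shows "grid_time T \<rho> (grid_size T \<rho>) = T"
  unfolding grid_size_def
proof (rule LeastI)
  have "T / \<rho> \<le> real (nat \<lceil>T / \<rho>\<rceil>)" by (rule real_nat_ceiling_ge)
  then have "T \<le> real (nat \<lceil>T / \<rho>\<rceil>) * \<rho>"
    by (simp only: pos_divide_le_eq[OF assms(2)])
  then show "grid_time T \<rho> (nat \<lceil>T / \<rho>\<rceil>) = T"
    unfolding grid_time_def by (rule min.absorb2)
qed

lemma grid_time_less:
  assumes "n < grid_size T \<rho>"
  shows "real n * \<rho> < T" and "grid_time T \<rho> n = real n * \<rho>"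
proof -
  have "grid_time T \<rho> n \<noteq> T"
    using assms not_less_Least unfolding grid_size_def by blast
  then show "real n * \<rho> < T" by (auto simp: grid_time_def min_def split: if_splits)
  then show "grid_time T \<rho> n = real n * \<rho>" by (simp add: grid_time_def)
qed

lemma grid_interval:
  assumes "0 < T" and "0 < \<rho>" and "0 < t" and "t \<le> T"
  obtains n where "n < grid_size T \<rho>" and "t \<in> {grid_time T \<rho> n<..grid_time T \<rho> (Suc n)}"
proof -
  define k where "k = (LEAST k. t \<le> grid_time T \<rho> k)"
  have N: "t \<le> grid_time T \<rho> (grid_size T \<rho>)"
    using grid_size_eq assms by simp
  have k: "t \<le> grid_time T \<rho> k"
    unfolding k_def using N by (rule LeastI)
  have "k \<le> grid_size T \<rho>"
    unfolding k_def using N by (rule Least_le)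
  moreover have "k \<noteq> 0"
  proof
    assume "k = 0"
    then show False using k assms by (simp add: grid_time_def)
  qed
  then obtain n where "k = Suc n" using not0_implies_Suc by blast
  moreover from this have "\<not> t \<le> grid_time T \<rho> n"
    using not_less_Least[of n "\<lambda>k. t \<le> grid_time T \<rho> k"] by (simp add: k_def)
  ultimately show thesis using that[of n] k by simp
qed

section \<open>Propagation of the estimate through one step and over the grid\<close>

context dc_hamiltonian
begin

text \<open>Discrete counterpart of \<open>pathwise_comparison\<close>: monotonicity and commutation
  with constants carry the ordering through the operator, and consistency replaces the image of the
  test function by its later value. The error comes from the Lipschitz constant 2/\<delta> of the
  gradient.\<close>

lemma scheme_step:
  assumes \<sigma>: "\<sigma> = 1 \<or> \<sigma> = - 1" and \<delta>: "0 < \<delta>"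
    and S: "scheme_operator H T lam0 C0 S" and "0 < h" and "0 \<le> C0"
    and \<zeta>: "continuous_on {0..T} \<zeta>" and st: "0 \<le> s" "s \<le> t" "t \<le> T"
    and osc: "osc \<zeta> s t \<le> lam0 * h" and w: "w \<in> UC" and "0 < \<epsilon>"
    and bd: "\<And>r. r \<in> {0..T} \<Longrightarrow> s - \<epsilon> < r \<Longrightarrow> r < t + \<epsilon> \<Longrightarrow> norm (\<zeta> r - c) \<le> \<kappa>'" and "\<kappa>' < \<kappa>"
    and init: "\<And>x. \<sigma> * w x \<le> a + \<sigma> * test \<sigma> \<delta> \<kappa> c \<zeta> y s x"
  shows "\<sigma> * S h t s \<zeta> w x \<le> a + C0 * (2 / \<delta>) * h\<^sup>2 + \<sigma> * test \<sigma> \<delta> \<kappa> c \<zeta> y t x"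
proof -
  \<comment> \<open>Consistency asks for an interval relatively open in [0,T] that contains
    \<open>s\<close> and \<open>t\<close>, hence the margin \<epsilon>.\<close>
  define I where "I = {0..T} \<inter> {s - \<epsilon><..<t + \<epsilon>}"
  let ?\<Phi> = "test \<sigma> \<delta> \<kappa> c \<zeta> y"
  have I: "is_interval I" "openin (top_of_set {0..T}) I" "s \<in> I" "t \<in> I" "I \<subseteq> {0..T}"
    unfolding I_def using st \<open>0 < \<epsilon>\<close>
    by (auto intro!: is_interval_Int openin_open_Int simp: is_interval_oo is_interval_cc)
  have bdI: "norm (\<zeta> r - c) \<le> \<kappa>'" if "r \<in> I" for r
    using bd that by (auto simp: I_def)
  then have bd\<kappa>: "norm (\<zeta> r - c) \<le> \<kappa>" if "r \<in> I" for r
    using that \<open>\<kappa>' < \<kappa>\<close> by fastforce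
  have smooth: "smooth_solution H I \<zeta> ?\<Phi>"
    using \<sigma> \<delta> \<zeta> I(5) bdI \<open>\<kappa>' < \<kappa>\<close> by (rule smooth_solution_test)
  have UC: "?\<Phi> s \<in> UC"
    using \<sigma> \<delta> bd\<kappa>[OF I(3)] by (rule test_in_UC)
  have hyps: "0 < h \<and> 0 \<le> s \<and> s \<le> t \<and> t \<le> T \<and> continuous_on {0..T} \<zeta>"
    using \<open>0 < h\<close> st \<zeta> by blast
  note S' = S[unfolded scheme_operator_def, rule_format, OF hyps]
  have mono: "S h t s \<zeta> w1 x \<le> S h t s \<zeta> w2 x" if "w1 \<in> UC" "w2 \<in> UC" "\<And>x. w1 x \<le> w2 x" for w1 w2 x
    using S' osc that by blast
  have shift: "S h t s \<zeta> (\<lambda>x. ?\<Phi> s x + b) x = S h t s \<zeta> (?\<Phi> s) x + b" for b x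
    using S' UC by metis
  have "ennreal \<bar>S h t s \<zeta> (?\<Phi> s) x - ?\<Phi> t x\<bar> \<le> ennreal C0 * D2_norm I ?\<Phi> * ennreal (h\<^sup>2)"
    using S' I(1-4) smooth UC osc by blast
  also have "\<dots> \<le> ennreal C0 * ennreal (2 / \<delta>) * ennreal (h\<^sup>2)"
    using D2_norm_test_le[OF \<sigma> \<delta> bd\<kappa>] by (intro mult_right_mono mult_left_mono) auto
  also have "\<dots> = ennreal (C0 * (2 / \<delta>) * h\<^sup>2)"
    using \<open>0 \<le> C0\<close> \<delta> by (simp add: ennreal_mult[symmetric] del: ennreal_mult'')
  finally have E: "\<bar>S h t s \<zeta> (?\<Phi> s) x - ?\<Phi> t x\<bar> \<le> C0 * (2 / \<delta>) * h\<^sup>2"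
    using \<open>0 \<le> C0\<close> \<delta> by (subst (asm) ennreal_le_iff) auto
  have UC_shift: "(\<lambda>x. ?\<Phi> s x + b) \<in> UC" for b
    using UC unfolding UC_def by (auto intro: uniformly_continuous_on_add uniformly_continuous_on_const)
  from \<sigma> show ?thesis
  proof
    assume [simp]: "\<sigma> = 1"
    have "S h t s \<zeta> w x \<le> S h t s \<zeta> (\<lambda>x. ?\<Phi> s x + a) x"
      using init by (intro mono w UC_shift) (simp add: add.commute)
    then show ?thesis using E unfolding shift by simp
  next
    assume [simp]: "\<sigma> = - 1"
    have "S h t s \<zeta> (\<lambda>x. ?\<Phi> s x + (- a)) x \<le> S h t s \<zeta> w x"
      using init by (intro mono w UC_shift) (simp add: algebra_simps)
    then show ?thesis using E unfolding shift by simp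
  qed
qed

lemma scheme_error:
  assumes "0 < T" and S: "scheme_operator H T lam0 C0 S" and "0 \<le> C0"
    and u0: "L-lipschitz_on UNIV u0" and W: "continuous_on {0..T} W"
    and modulus: "modulus_of_continuity T \<omega> W" and "0 < h" and "0 < \<rho>"
    and lam: "0 < lam" "sqrt \<rho> * \<omega> (sqrt \<rho>) / h = lam" "lam \<le> lam0 * (sqrt \<rho> * real (coarse_steps \<rho>))"
    and uh: "scheme_solution S T W u0 h \<rho> uh" and u: "pathwise_BUC_solution H T W u0 u"
    and t: "t \<in> {0..T}"
  shows "\<bar>uh t x - u t x\<bar> \<le> (L\<^sup>2 / 2 + 8 * B + 2 * C0 / lam\<^sup>2) * (1 + T) * \<omega> (sqrt \<rho>)"
proof -
  define m where "m = \<omega> (sqrt \<rho>)"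
  define Wh where "Wh = interpolated_path T W \<rho>"
  define tn where "tn = grid_time T \<rho>"
  have "0 < m"
    using lam \<open>0 < h\<close> \<open>0 < \<rho>\<close> by (auto simp: m_def zero_less_divide_iff zero_less_mult_iff)
  have "coarse_steps \<rho> \<noteq> 0"
  proof
    assume "coarse_steps \<rho> = 0"
    then have "lam \<le> 0" using lam(3) by simp
    with lam(1) show False by simp
  qed
  then interpret path_interpolation T \<rho> \<omega> W
    by unfold_locales (use \<open>0 < T\<close> \<open>0 < \<rho>\<close> modulus in auto)
  have Wh_cont: "continuous_on {0..T} Wh"
    unfolding Wh_def using continuous_on_interpolated_path by (rule continuous_on_subset) auto
  \<comment> \<open>The error of \<open>scheme_step\<close> for \<delta> = \<open>m\<close>.\<close>
  define E where "E = C0 * (2 / m) * h\<^sup>2"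
  \<comment> \<open>Doubled variables: \<open>x\<close> is driven by \<open>Wh\<close> and
    \<open>y\<close> by \<open>W\<close>, and the penalty sees only the difference of the paths,
    which is at most \<open>m\<close>.\<close>
  define inv where "inv \<sigma> a w t \<longleftrightarrow>
      (\<forall>x y. \<sigma> * (w x - u t y) \<le> a + V m (4 * m) (\<sigma> *\<^sub>R (Wh t - W t)) (\<sigma> *\<^sub>R (x - y)))"
    for \<sigma> a and w :: "real ^ 'd \<Rightarrow> real" and t

  have step: "inv \<sigma> (a + E) (S h t s Wh w) t"
    if \<sigma>: "\<sigma> = 1 \<or> \<sigma> = - 1" and st: "0 \<le> s" "s \<le> t" "t \<le> s + \<rho>" "t \<le> T"
      and w: "w \<in> UC" and inv: "inv \<sigma> a w s" for \<sigma> a s t w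
    unfolding inv_def
  proof (intro allI)
    fix x y
    have "osc Wh s t \<le> m * \<rho> / \<tau>"
      unfolding Wh_def m_def using st by (intro osc_interpolated_path_le) auto
    also have "\<dots> = m / real (coarse_steps \<rho>)"
      using \<open>0 < \<rho>\<close> by (simp add: \<tau>_def)
    \<comment> \<open>The rounding hypothesis on \<open>lam\<close> enters here and yields the
      oscillation bound required for one step.\<close>
    also have "m \<le> lam0 * h * real (coarse_steps \<rho>)"
    proof -
      have "sqrt \<rho> * m \<le> sqrt \<rho> * (lam0 * h * real (coarse_steps \<rho>))"
        using lam \<open>0 < h\<close> unfolding m_def by (auto simp: divide_le_eq mult_ac)
      then show ?thesis using \<open>0 < \<rho>\<close> by simp
    qed
    then have "m / real (coarse_steps \<rho>) \<le> lam0 * h"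
      using steps_pos by (simp add: pos_divide_le_eq)
    finally have osc: "osc Wh s t \<le> lam0 * h" .
    \<comment> \<open>On the enlarged interval \<open>r\<close> is within two coarse steps of
      \<open>s\<close>, which costs \<open>2 * m\<close>; the distance of the paths adds
      \<open>m\<close>. The total stays strictly below \<kappa> = \<open>4 * m\<close>.\<close>
    have near: "norm (Wh r - W s) \<le> 3 * m" if r: "r \<in> {0..T}" "s - \<rho> < r" "r < t + \<rho>" for r
    proof -
      have "norm (Wh r - Wh s) \<le> m * \<bar>r - s\<bar> / \<tau>"
        unfolding Wh_def m_def using r st by (intro interpolated_path_lipschitz) auto
      also have "\<dots> \<le> m * (2 * \<tau>) / \<tau>"
        using r st \<rho>_le_\<tau> \<tau>_pos \<open>0 < m\<close> by (intro divide_right_mono mult_left_mono) auto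
      also have "\<dots> = 2 * m" using \<tau>_pos by simp
      finally have "norm (Wh r - Wh s) \<le> 2 * m" .
      moreover have "norm (Wh s - W s) \<le> m"
        unfolding Wh_def m_def using st by (intro interpolated_path_close) auto
      ultimately show ?thesis
        using norm_triangle_ineq[of "Wh r - Wh s" "Wh s - W s"] by simp
    qed
    \<comment> \<open>First half step: with \<open>y'\<close> and \<open>W s\<close> frozen, the
      scheme advances \<open>Wh\<close> to time \<open>t\<close>.\<close>
    have scheme: "\<sigma> * S h t s Wh w x \<le> (\<sigma> * u s y' + a) + E + V m (4 * m) (\<sigma> *\<^sub>R (Wh t - W s)) (\<sigma> *\<^sub>R (x - y'))" for y'
    proof -
      have "\<sigma> * S h t s Wh w x \<le> (\<sigma> * u s y' + a) + C0 * (2 / m) * h\<^sup>2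
          + \<sigma> * test \<sigma> m (4 * m) (W s) Wh y' t x"
      proof (rule scheme_step[OF \<sigma> \<open>0 < m\<close> S \<open>0 < h\<close> \<open>0 \<le> C0\<close> Wh_cont st(1,2,4) osc w \<open>0 < \<rho>\<close> near])
        fix x'
        have "\<sigma> * (w x' - u s y') \<le> a + V m (4 * m) (\<sigma> *\<^sub>R (Wh s - W s)) (\<sigma> *\<^sub>R (x' - y'))"
          using inv unfolding inv_def by blast
        then show "\<sigma> * w x' \<le> \<sigma> * u s y' + a + \<sigma> * test \<sigma> m (4 * m) (W s) Wh y' s x'"
          using \<sigma> by (auto simp: test_def algebra_simps)
      qed (use \<open>0 < m\<close> in auto)
      then show ?thesis using \<sigma> by (auto simp: test_def E_def)
    qed
    \<comment> \<open>Second half step: with \<open>x\<close> and \<open>Wh t\<close> frozen,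
      \<open>u\<close> follows \<open>W\<close> to time \<open>t\<close>. Since \<open>u\<close>
      enters with the opposite sign, so does the test function.\<close>
    have "- \<sigma> * u t y \<le> (a + E - \<sigma> * S h t s Wh w x) + - \<sigma> * test (- \<sigma>) m (4 * m) (Wh t) W x t y"
    proof (rule pathwise_comparison[OF _ \<open>0 < m\<close> u W st(1,2,4)])
      show "- \<sigma> = 1 \<or> - \<sigma> = - 1" using \<sigma> by auto
      show "norm (W r - Wh t) \<le> 2 * m" if "r \<in> {s..t}" for r
      proof -
        have "norm (W r - W t) \<le> m"
          unfolding m_def using that st \<rho>_le_\<tau> \<tau>_le_sqrt by (intro path_diff_le) auto
        moreover have "norm (W t - Wh t) \<le> m"
          unfolding Wh_def m_def norm_minus_commute[of "W t"] using st by (intro interpolated_path_close) auto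
        ultimately show ?thesis
          using norm_triangle_ineq[of "W r - W t" "W t - Wh t"] by simp
      qed
      show "2 * m < 4 * m" using \<open>0 < m\<close> by simp
      show "- \<sigma> * u s y' \<le> (a + E - \<sigma> * S h t s Wh w x) + - \<sigma> * test (- \<sigma>) m (4 * m) (Wh t) W x s y'" for y'
        using scheme[of y'] \<sigma> by (auto simp: test_def)
    qed
    then show "\<sigma> * (S h t s Wh w x - u t y) \<le> a + E + V m (4 * m) (\<sigma> *\<^sub>R (Wh t - W t)) (\<sigma> *\<^sub>R (x - y))"
      using \<sigma> by (auto simp: test_def)
  qed

  \<comment> \<open>The defect in \<open>V_ge\<close> for \<delta> = \<open>m\<close> and \<kappa> =
    \<open>4 * m\<close>; adding it lets the penalty dominate
    \<open>L * norm (x - y)\<close>.\<close>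
  define A where "A = m / 2 * L\<^sup>2 + 2 * (4 * m) * B"
  have close: "norm (\<sigma> *\<^sub>R (Wh r - W r)) \<le> 4 * m"
    if "\<sigma> = 1 \<or> \<sigma> = - 1" "r \<in> {0..T}" for \<sigma> r
  proof -
    have "norm (\<sigma> *\<^sub>R (Wh r - W r)) = norm (Wh r - W r)"
      using that(1) by auto
    also have "\<dots> \<le> m"
      unfolding Wh_def m_def using that(2) by (rule interpolated_path_close)
    finally show ?thesis using \<open>0 < m\<close> by simp
  qed
  have uh0: "uh 0 = u0"
    using uh by (simp add: scheme_solution_def)
  have inv0: "inv \<sigma> A (uh 0) 0" if \<sigma>: "\<sigma> = 1 \<or> \<sigma> = - 1" for \<sigma>
    unfolding inv_def
  proof (intro allI)
    fix x y
    have "u 0 y = u0 y"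
      using u unfolding pathwise_BUC_solution_def pathwise_subsolution_def pathwise_supersolution_def
      by (meson order_antisym)
    moreover have "\<sigma> * (u0 x - u0 y) \<le> L * norm (x - y)"
      using lipschitz_on_normD[OF u0, of x y] \<sigma> by auto
    moreover have "\<bar>\<sigma>\<bar> = 1"
      using \<sigma> by auto
    then have "V m (4 * m) (\<sigma> *\<^sub>R (Wh 0 - W 0)) (\<sigma> *\<^sub>R (x - y)) \<ge>
        L * norm (x - y) - m / 2 * L\<^sup>2 - 2 * (4 * m) * B"
      using V_ge[OF close[OF \<sigma>, of 0], of m "\<sigma> *\<^sub>R (x - y)"] \<open>0 < T\<close> \<open>0 < m\<close> by simp
    ultimately show "\<sigma> * (uh 0 x - u 0 y) \<le> A + V m (4 * m) (\<sigma> *\<^sub>R (Wh 0 - W 0)) (\<sigma> *\<^sub>R (x - y))"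
      unfolding A_def uh0 by simp
  qed
  have tn_step: "0 \<le> tn n" "tn n < tn (Suc n)" "tn (Suc n) \<le> tn n + \<rho>" "tn (Suc n) \<le> T"
    if "n < grid_size T \<rho>" for n
    using grid_time_less[OF that] \<open>0 < \<rho>\<close> unfolding tn_def by (auto simp: grid_time_def distrib_right)
  have uh_step: "uh t = S h t (tn n) Wh (uh (tn n))"
    if "n < grid_size T \<rho>" "t \<in> {tn n<..tn (Suc n)}" for n t
    using uh that unfolding scheme_solution_def tn_def Wh_def by blast
  \<comment> \<open>Uniform continuity is carried along to stay in the domain of the
    operators.\<close>
  have main: "n \<le> grid_size T \<rho> \<Longrightarrow> uh (tn n) \<in> UC \<and>
      (\<forall>\<sigma>. \<sigma> = 1 \<or> \<sigma> = - 1 \<longrightarrow> inv \<sigma> (A + real n * E) (uh (tn n)) (tn n))" for n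
  proof (induction n)
    case 0
    have "tn 0 = 0" using \<open>0 < T\<close> by (simp add: tn_def grid_time_def)
    then show ?case using inv0 lipschitz_in_UC[OF u0] by (simp add: uh0)
  next
    case (Suc n)
    then have n: "n < grid_size T \<rho>" by simp
    have eq: "uh (tn (Suc n)) = S h (tn (Suc n)) (tn n) Wh (uh (tn n))"
      using tn_step[OF n] by (intro uh_step n) auto
    have IH: "uh (tn n) \<in> UC" "\<And>\<sigma>. \<sigma> = 1 \<or> \<sigma> = - 1 \<Longrightarrow> inv \<sigma> (A + real n * E) (uh (tn n)) (tn n)"
      using Suc n by auto
    have "S h (tn (Suc n)) (tn n) Wh ` UC \<subseteq> UC"
      using S[unfolded scheme_operator_def] tn_step[OF n] \<open>0 < h\<close> Wh_cont by (meson less_imp_le)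
    then have "uh (tn (Suc n)) \<in> UC" using IH(1) eq by auto
    moreover have "inv \<sigma> (A + real n * E + E) (uh (tn (Suc n))) (tn (Suc n))"
      if "\<sigma> = 1 \<or> \<sigma> = - 1" for \<sigma>
      unfolding eq using tn_step[OF n] by (intro step that IH) auto
    ultimately show ?case by (simp add: algebra_simps)
  qed
  \<comment> \<open>A time off the grid is reached by one shortened step, also of cost
    \<open>E\<close>; hence \<open>k + 1\<close> steps are counted, and \<rho> \<le> 1 bounds their
    total length.\<close>
  obtain n where n: "real n * \<rho> \<le> T + 1" "\<And>\<sigma>. \<sigma> = 1 \<or> \<sigma> = - 1 \<Longrightarrow> inv \<sigma> (A + real n * E) (uh t) t"
  proof (cases "t = 0")
    case True
    then show thesis using that[of 0] inv0 \<open>0 < T\<close> by simp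
  next
    case False
    then have "0 < t" "t \<le> T" using t by auto
    then obtain k where k: "k < grid_size T \<rho>" "t \<in> {tn k<..tn (Suc k)}"
      using grid_interval \<open>0 < T\<close> \<open>0 < \<rho>\<close> unfolding tn_def by blast
    have "real (Suc k) * \<rho> \<le> T + 1"
      using grid_time_less(1)[OF k(1)] \<rho>_le_1 by (simp add: distrib_right)
    moreover have "inv \<sigma> (A + real k * E + E) (uh t) t" if "\<sigma> = 1 \<or> \<sigma> = - 1" for \<sigma>
      unfolding uh_step[OF k] using tn_step[OF k(1)] k that main[of k] by (intro step) auto
    then have "inv \<sigma> (A + real (Suc k) * E) (uh t) t" if "\<sigma> = 1 \<or> \<sigma> = - 1" for \<sigma>
      using that by (simp add: algebra_simps)
    ultimately show thesis using that by blast
  qed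
  \<comment> \<open>On the diagonal the penalty is nonpositive and drops out.\<close>
  have "\<sigma> * (uh t x - u t x) \<le> A + real n * E" if \<sigma>: "\<sigma> = 1 \<or> \<sigma> = - 1" for \<sigma>
  proof -
    have "V m (4 * m) (\<sigma> *\<^sub>R (Wh t - W t)) 0 \<le> 0"
      using close[OF \<sigma> t] \<open>0 < m\<close> by (intro V_zero_le) auto
    moreover have "\<sigma> * (uh t x - u t x) \<le> A + real n * E + V m (4 * m) (\<sigma> *\<^sub>R (Wh t - W t)) (\<sigma> *\<^sub>R (x - x))"
      using n(2)[OF \<sigma>] unfolding inv_def by blast
    ultimately show ?thesis by simp
  qed
  from this[of 1] this[of "- 1"] have "\<bar>uh t x - u t x\<bar> \<le> A + real n * E"
    by (simp add: abs_le_iff)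
  \<comment> \<open>The relation defining \<open>lam\<close> turns \<open>h^2\<close> into
    \<open>\<rho> * m^2 / lam^2\<close>, so the accumulated error is of order \<open>m\<close> times
    the total length of the steps.\<close>
  also have "real n * E = (real n * \<rho>) * (2 * C0 / lam\<^sup>2 * m)"
  proof -
    have "h = sqrt \<rho> * m / lam"
      using lam \<open>0 < h\<close> unfolding m_def by (auto simp: field_simps)
    then have "h\<^sup>2 = \<rho> * m\<^sup>2 / lam\<^sup>2"
      using \<open>0 < \<rho>\<close> by (simp add: power_mult_distrib power_divide)
    then show ?thesis
      using \<open>0 < m\<close> by (simp add: E_def power2_eq_square)
  qed
  also have "\<dots> \<le> (T + 1) * (2 * C0 / lam\<^sup>2 * m)"
    using n(1) \<open>0 \<le> C0\<close> \<open>0 < m\<close> by (intro mult_right_mono) auto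
  also have "A = (L\<^sup>2 / 2 + 8 * B) * m"
    by (simp add: A_def algebra_simps)
  also have "\<dots> \<le> (T + 1) * ((L\<^sup>2 / 2 + 8 * B) * m)"
    using \<open>0 < T\<close> B_nonneg \<open>0 < m\<close> mult_right_mono[of 1 "T + 1" "(L\<^sup>2 / 2 + 8 * B) * m"] by simp
  finally show ?thesis
    by (simp add: m_def algebra_simps)
qed

end

section \<open>A constant uniform in the time horizon, the scheme, the path and the data\<close>

theorem theorem6p1:
  fixes H H1 H2 :: "real ^ 'd \<Rightarrow> real ^ 'm"
    and L lam lam0 C0 :: real
  assumes "0 < L"
    and "\<And>p. H p = H1 p - H2 p"
    and "\<And>i. convex_on UNIV (\<lambda>p. H1 p $ i)" and "\<And>i. convex_on UNIV (\<lambda>p. H2 p $ i)"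
    and "\<And>p i. 0 \<le> H1 p $ i" and "\<And>p i. 0 \<le> H2 p $ i"
    and "\<exists>K. K-lipschitz_on UNIV H"
    and "0 < lam0" and "0 < C0" and "0 < lam" and "lam < lam0"
  shows "\<exists>C>0. \<forall>(T::real) S u0 W \<omega> (h::real) \<rho> uh u.
           0 < T \<and>
           scheme_operator H T lam0 C0 S \<and>
           bounded (range u0) \<and> L-lipschitz_on UNIV u0 \<and>
           continuous_on {0..T} W \<and> modulus_of_continuity T \<omega> W \<and>
           0 < h \<and> 0 < \<rho> \<and> sqrt \<rho> * \<omega> (sqrt \<rho>) / h = lam \<and>
           lam \<le> lam0 * (sqrt \<rho> * real (coarse_steps \<rho>)) \<and>
           scheme_solution S T W u0 h \<rho> uh \<and>
           pathwise_BUC_solution H T W u0 u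
           \<longrightarrow> (\<forall>x. \<forall>t\<in>{0..T}. \<bar>uh t x - u t x\<bar> \<le> C * (1 + T) * \<omega> (sqrt \<rho>))"
proof -
  \<comment> \<open>Compactness of the ball of radius \<open>L\<close> provides the bounds that make
    up \<open>B\<close>.\<close>
  have contH: "continuous_on UNIV H"
    using assms(7) lipschitz_on_continuous_on by blast
  have cont_sum: "continuous_on (cball 0 L) (\<lambda>p. \<Sum>i\<in>UNIV. H1 p $ i + H2 p $ i)"
    by (intro continuous_on_sum continuous_on_add continuous_on_subset[OF convex_on_continuous[OF open_UNIV]]
        assms(3,4) subset_UNIV)
  have "bounded (H ` cball 0 L)"
    by (intro compact_imp_bounded compact_continuous_image compact_cball continuous_on_subset[OF contH]) simp
  then obtain B1 where "\<forall>v\<in>H ` cball 0 L. norm v \<le> B1"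
    unfolding bounded_iff by blast
  then have B1: "norm (H p) \<le> B1" if "norm p \<le> L" for p
    using that by simp
  have "bounded ((\<lambda>p. \<Sum>i\<in>UNIV. H1 p $ i + H2 p $ i) ` cball 0 L)"
    by (intro compact_imp_bounded compact_continuous_image compact_cball cont_sum)
  then obtain B2 where "\<forall>v\<in>(\<lambda>p. \<Sum>i\<in>UNIV. H1 p $ i + H2 p $ i) ` cball 0 L. norm v \<le> B2"
    unfolding bounded_iff by blast
  then have B2: "norm (\<Sum>i\<in>UNIV. H1 p $ i + H2 p $ i) \<le> B2" if "norm p \<le> L" for p
    using that by simp
  interpret dc_hamiltonian H H1 H2 L "max B1 B2"
  proof
    show "norm (H p) \<le> max B1 B2" if "norm p \<le> L" for p
      using B1[OF that] by simp
    show "(\<Sum>i\<in>UNIV. H1 p $ i + H2 p $ i) \<le> max B1 B2" if "norm p \<le> L" for p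
      using B2[OF that] unfolding real_norm_def by linarith
  qed (use assms contH in auto)
  \<comment> \<open>The first two terms come from the penalty at the initial time, the last from the
    accumulated consistency errors.\<close>
  define C where "C = L\<^sup>2 / 2 + 8 * max B1 B2 + 2 * C0 / lam\<^sup>2"
  have "0 < C"
    unfolding C_def using assms(1,9,10) B_nonneg by (intro add_nonneg_pos add_nonneg_nonneg) auto
  moreover have "\<bar>uh t x - u t x\<bar> \<le> C * (1 + T) * \<omega> (sqrt \<rho>)"
    if "0 < T" "scheme_operator H T lam0 C0 S" "L-lipschitz_on UNIV u0" "continuous_on {0..T} W"
      "modulus_of_continuity T \<omega> W" "0 < h" "0 < \<rho>" "sqrt \<rho> * \<omega> (sqrt \<rho>) / h = lam"
      "lam \<le> lam0 * (sqrt \<rho> * real (coarse_steps \<rho>))" "scheme_solution S T W u0 h \<rho> uh"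
      "pathwise_BUC_solution H T W u0 u" "t \<in> {0..T}" for T S u0 W \<omega> h \<rho> uh u x t
    unfolding C_def by (rule scheme_error) (use that assms(9,10) in auto)
  ultimately show ?thesis
    by blast
qed

end
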